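(* Let $d\ge 1$ and let $M\subseteq\mathbb{Z}^d$. Then $M$ is definable in $\langle\mathbb{Z};<,+\rangle$ if and only if $R_M(n)\in\mathcal{O}(n^{d-1})$ and every section $M_{i,c}$ ($i\in\{1,\ldots,d\}$, $c\in\mathbb{Z}$) of $M$ is definable in $\langle\mathbb{Z};<,+\rangle$.
   Context: A set $M\subseteq\mathbb{Z}^d$ is definable in $\langle\mathbb{Z};<,+\rangle$ if it is the set of tuples satisfying some first-order formula with $d$ free variables in the language with the order $<$ and addition $+$ interpreted in $\mathbb{Z}$ (Presburger arithmetic over $\mathbb{Z}$). Norm: $\|\mathbf{x}\|=\max_i|\mathbf{x}_i|$. For $\mathbf{x}\in\mathbb{Z}^d$ and $n\ge1$, the block of size $n$ at $\mathbf{x}$, $M_{\mathbf{x},n}$, is the map $[\![0,n-1]\!]^d\to\{0,1\}$, $\mathbf{v}\mapsto \mathbf{1}_M(\mathbf{x}+\mathbf{v})$; two blocks $M_{\mathbf{x},n},M_{\mathbf{y},n}$ are equal iff these maps coincide. A block $B$ of size $n$ is recurrent if for every $L\in\mathbb{N}$ there is $\mathbf{x}$ with $\|\mathbf{x}\|\ge L$ and $M_{\mathbf{x},n}=B$. The recurrent block complexity $R_M(n)$ is the number of distinct recurrent blocks of size $n$. For $i\in\{1,\ldots,d\}$ and $c\in\mathbb{Z}$, the section $M_{i,c}\subseteq\mathbb{Z}^{d-1}$ is $\{(x_1,\ldots,x_{i-1},x_{i+1},\ldots,x_d)\mid (x_1,\ldots,x_{i-1},c,x_{i+1},\ldots,x_d)\in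 M\}$. *)

theory Defs
  imports Complex_Main "HOL-Library.FuncSet" "HOL-Library.Indicator_Function"
    "HOL-Library.Landau_Symbols"
begin

text \<open>First-order formulas over the language with \<open><\<close> and \<open>+\<close> (and logical equality).
  Variables are de Bruijn indices: a quantifier binds index 0 of its body. In a formula with
  \<open>d\<close> free variables, indices \<open>0, \<dots>, d - 1\<close> refer to the coordinates of the tuple.\<close>

datatype pterm = Var nat | Plus pterm pterm

datatype pform =
    Less pterm pterm
  | Equal pterm pterm
  | Neg pform
  | Conj pform pform
  | Disj pform pform
  | Impl pform pform
  | Exists pform
  | Forall pform

primrec term_val :: "int list \<Rightarrow> pterm \<Rightarrow> int" where
  "term_val e (Var i) = e ! i"
| "term_val e (Plus s t) = term_val e s + term_val e t"

primrec holds :: "int list \<Rightarrow> pform \<Rightarrow> bool" where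
  "holds e (Less s t) \<longleftrightarrow> term_val e s < term_val e t"
| "holds e (Equal s t) \<longleftrightarrow> term_val e s = term_val e t"
| "holds e (Neg p) \<longleftrightarrow> \<not> holds e p"
| "holds e (Conj p q) \<longleftrightarrow> holds e p \<and> holds e q"
| "holds e (Disj p q) \<longleftrightarrow> holds e p \<or> holds e q"
| "holds e (Impl p q) \<longleftrightarrow> (holds e p \<longrightarrow> holds e q)"
| "holds e (Exists p) \<longleftrightarrow> (\<exists>a. holds (a # e) p)"
| "holds e (Forall p) \<longleftrightarrow> (\<forall>a. holds (a # e) p)"

primrec term_vars_below :: "nat \<Rightarrow> pterm \<Rightarrow> bool" where
  "term_vars_below d (Var i) \<longleftrightarrow> i < d"
| "term_vars_below d (Plus s t) \<longleftrightarrow> term_vars_below d s \<and> term_vars_below d t"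

text \<open>All free variables have an index below \<open>d\<close>.\<close>

primrec free_vars_below :: "nat \<Rightarrow> pform \<Rightarrow> bool" where
  "free_vars_below d (Less s t) \<longleftrightarrow> term_vars_below d s \<and> term_vars_below d t"
| "free_vars_below d (Equal s t) \<longleftrightarrow> term_vars_below d s \<and> term_vars_below d t"
| "free_vars_below d (Neg p) \<longleftrightarrow> free_vars_below d p"
| "free_vars_below d (Conj p q) \<longleftrightarrow> free_vars_below d p \<and> free_vars_below d q"
| "free_vars_below d (Disj p q) \<longleftrightarrow> free_vars_below d p \<and> free_vars_below d q"
| "free_vars_below d (Impl p q) \<longleftrightarrow> free_vars_below d p \<and> free_vars_below d q"
| "free_vars_below d (Exists p) \<longleftrightarrow> free_vars_below (Suc d) p"
| "free_vars_below d (Forall p) \<longleftrightarrow> free_vars_below (Suc d) p"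

text \<open>Elements of \<open>\<int>\<^sup>d\<close> are integer lists of length \<open>d\<close>, since sections relate
  dimension \<open>d\<close> to dimension \<open>d - 1\<close>.\<close>

definition int_vecs :: "nat \<Rightarrow> int list set" where
  "int_vecs d = {x. length x = d}"

definition presburger_definable :: "nat \<Rightarrow> int list set \<Rightarrow> bool" where
  "presburger_definable d M \<longleftrightarrow>
     (\<exists>p. free_vars_below d p \<and> M = {x \<in> int_vecs d. holds x p})"

text \<open>Only meaningful for nonempty lists, i.e. in dimension \<open>d \<ge> 1\<close>.\<close>

definition max_norm :: "int list \<Rightarrow> int" where
  "max_norm x = Max (abs ` set x)"

definition int_box :: "nat \<Rightarrow> nat \<Rightarrow> int list set" where
  "int_box d n = {v \<in> int_vecs d. set v \<subseteq> {0..int n - 1}}"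

text \<open>Blocks are \<open>undefined\<close> outside the box, so that equality of blocks is equality of the
  maps on the box.\<close>

definition block :: "nat \<Rightarrow> int list set \<Rightarrow> int list \<Rightarrow> nat \<Rightarrow> (int list \<Rightarrow> nat)" where
  "block d M x n = (\<lambda>v\<in>int_box d n. indicator M (map2 (+) x v))"

definition recurrent_block :: "nat \<Rightarrow> int list set \<Rightarrow> nat \<Rightarrow> (int list \<Rightarrow> nat) \<Rightarrow> bool" where
  "recurrent_block d M n B \<longleftrightarrow>
     (\<forall>L::nat. \<exists>x\<in>int_vecs d. max_norm x \<ge> int L \<and> block d M x n = B)"

definition recurrent_complexity :: "nat \<Rightarrow> int list set \<Rightarrow> nat \<Rightarrow> nat" where
  "recurrent_complexity d M n = card {B. recurrent_block d M n B}"

text \<open>The coordinate index \<open>i\<close> is counted from 1.\<close>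

definition section_at :: "nat \<Rightarrow> int \<Rightarrow> int list set \<Rightarrow> int list set" where
  "section_at i c M = {xs @ ys | xs ys. length xs = i - 1 \<and> xs @ c # ys \<in> M}"

end

theory Submission
  imports Defs "HOL-Decision_Procs.Cooper" "HOL-Number_Theory.Cong"
    "HOL-Computational_Algebra.Primes" "HOL-Library.Function_Algebras" "HOL-Library.Poly_Mapping"
begin

text \<open>
  If \<open>M\<close> is definable, quantifier elimination shows that membership in \<open>M\<close> depends only on
  finitely many half spaces and on residues. Far from the origin, the hyperplanes that cut a block of
  size \<open>n\<close> have normal vectors of rank less than \<open>d\<close>, so the cut is described by at most \<open>d - 1\<close>
  numbers of size \<open>O(n)\<close>.

  Conversely, let \<open>f\<close> be the indicator function of \<open>M\<close>. As soon as \<open>R\<^sub>M(n) < n\<^sup>d\<close> for a single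
  \<open>n\<close>, some nonzero integer combination of the entries of a block vanishes on all recurrent blocks, i.e.
  there is a Laurent polynomial \<open>P = \<Sum> c\<^sub>a X\<^sup>a \<noteq> 0\<close> such that \<open>P f\<close> has finite
  support. By the Frobenius congruence \<open>P\<^sup>p \<equiv> P(X\<^sup>p)\<close> modulo a large prime \<open>p\<close> and
  boundedness of \<open>f\<close>, the function \<open>P(X\<^sup>m) f\<close> has finite support for every \<open>m = 1 + q j\<close>, where
  \<open>q\<close> is a suitable factorial. Eliminating between these relations as for a Vandermonde matrix
  shows that \<open>\<Prod> (X\<^bsup>q a\<^sub>0\<^esup> - X\<^bsup>q a\<^esup>) f\<close> has finite support, the product ranging over
  the exponents \<open>a \<noteq> a\<^sub>0\<close> of \<open>P\<close>. Finally the factors are removed one at a time: a bounded function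
  with definable sections and a definable increment in a direction \<open>v\<close> is definable, because along each
  line it is periodic up to a bounded number of jumps.
\<close>

section \<open>Quantifier elimination\<close>

primrec cooper_num :: "pterm \<Rightarrow> num" where
  "cooper_num (Var i) = Bound i"
| "cooper_num (Plus s t) = Add (cooper_num s) (cooper_num t)"

primrec cooper_fm :: "pform \<Rightarrow> fm" where
  "cooper_fm (Less s t) = Lt (Sub (cooper_num s) (cooper_num t))"
| "cooper_fm (Equal s t) = Eq (Sub (cooper_num s) (cooper_num t))"
| "cooper_fm (pform.Neg p) = Cooper.Not (cooper_fm p)"
| "cooper_fm (Conj p q) = And (cooper_fm p) (cooper_fm q)"
| "cooper_fm (Disj p q) = Or (cooper_fm p) (cooper_fm q)"
| "cooper_fm (Impl p q) = Imp (cooper_fm p) (cooper_fm q)"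
| "cooper_fm (Exists p) = E (cooper_fm p)"
| "cooper_fm (Forall p) = A (cooper_fm p)"

lemma Inum_cooper_num: "Inum e (cooper_num t) = term_val e t"
  by (induction t) auto

lemma Ifm_cooper_fm: "Ifm [] e (cooper_fm p) \<longleftrightarrow> holds e p"
  by (induction p arbitrary: e) (auto simp: Inum_cooper_num)

section \<open>Cells cut out by half spaces and residue classes\<close>

definition lin :: "nat \<Rightarrow> (nat \<Rightarrow> int) \<Rightarrow> (nat \<Rightarrow> int) \<Rightarrow> int" where
  "lin d a x = (\<Sum>i<d. a i * x i)"

text \<open>Points of \<open>Z^d\<close> are functions on \<open>nat\<close> of which only the
  coordinates below \<open>d\<close> are read, so that they add pointwise. The pairs in
  \<open>H\<close> are the half spaces of an arrangement; its cells are refined by residues modulo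
  \<open>N\<close>.\<close>

definition same_cell ::
    "nat \<Rightarrow> ((nat \<Rightarrow> int) \<times> int) set \<Rightarrow> int \<Rightarrow> (nat \<Rightarrow> int) \<Rightarrow> (nat \<Rightarrow> int) \<Rightarrow> bool" where
  "same_cell d H N x y \<longleftrightarrow>
     (\<forall>(a, b)\<in>H. lin d a x \<le> b \<longleftrightarrow> lin d a y \<le> b) \<and> (\<forall>i<d. [x i = y i] (mod N))"

text \<open>A semantic substitute for quantifier-free normal forms. The value type is arbitrary,
  since the notion serves both for predicates and for integer-valued increments.\<close>

definition quasi_affine :: "nat \<Rightarrow> ((nat \<Rightarrow> int) \<Rightarrow> 'a) \<Rightarrow> bool" where
  "quasi_affine d f \<longleftrightarrow>
     (\<exists>H N. finite H \<and> N > 0 \<and> (\<forall>x y. same_cell d H N x y \<longrightarrow> f x = f y))"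

lemma same_cell_mono:
  "same_cell d H' N' x y \<Longrightarrow> H \<subseteq> H' \<Longrightarrow> N dvd N' \<Longrightarrow> same_cell d H N x y"
  unfolding same_cell_def by (blast intro: cong_dvd_modulus)

text \<open>The union of the half spaces and the product of the moduli give a common refinement of
  the two cell decompositions.\<close>

lemma quasi_affine_combine:
  assumes "quasi_affine d f" "quasi_affine d g"
  shows "quasi_affine d (\<lambda>x. op (f x) (g x))"
proof -
  obtain H N where 1: "finite H" "N > 0" "\<And>x y. same_cell d H N x y \<Longrightarrow> f x = f y"
    using assms(1) unfolding quasi_affine_def by blast
  obtain H' N' where 2: "finite H'" "N' > 0" "\<And>x y. same_cell d H' N' x y \<Longrightarrow> g x = g y"
    using assms(2) unfolding quasi_affine_def by blast
  have "op (f x) (g x) = op (f y) (g y)" if "same_cell d (H \<union> H') (N * N') x y" for x y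
  proof -
    have "same_cell d H N x y" "same_cell d H' N' x y"
      by (rule same_cell_mono[OF that]; simp)+
    then show ?thesis using 1(3) 2(3) by metis
  qed
  then show ?thesis
    unfolding quasi_affine_def using 1 2
    by (intro exI[of _ "H \<union> H'"] exI[of _ "N * N'"]) auto
qed

lemma quasi_affine_const: "quasi_affine d (\<lambda>x. c)"
  unfolding quasi_affine_def by (intro exI[of _ "{}"] exI[of _ 1]) auto

lemma quasi_affine_map: "quasi_affine d f \<Longrightarrow> quasi_affine d (\<lambda>x. op (f x))"
  using quasi_affine_combine[of d f f "\<lambda>u _. op u"] by simp

lemma quasi_affine_halfspace: "quasi_affine d (\<lambda>x. lin d a x + b \<le> 0)"
  unfolding quasi_affine_def
  by (intro exI[of _ "{(a, - b)}"] exI[of _ 1])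
     (auto simp: same_cell_def; smt (verit))

lemma quasi_affine_eq: "quasi_affine d (\<lambda>x. lin d a x + b = 0)"
proof -
  have eq: "lin d a x + b = 0 \<longleftrightarrow> lin d a x + b \<le> 0 \<and> \<not> lin d a x + (b + 1) \<le> 0" for x
    by linarith
  show ?thesis unfolding eq
    by (rule quasi_affine_combine[where op="\<lambda>u v. u \<and> \<not> v"]; rule quasi_affine_halfspace)
qed

lemma cong_lin: "(\<And>i. i < d \<Longrightarrow> [x i = y i] (mod N)) \<Longrightarrow> [lin d a x = lin d a y] (mod N)"
  unfolding lin_def by (intro cong_sum cong_mult) auto

lemma quasi_affine_dvd: "quasi_affine d (\<lambda>x. m dvd lin d a x + b)"
proof (cases "m = 0")
  case True
  \<comment> \<open>\<open>0 dvd z\<close> means \<open>z = 0\<close>.\<close>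
  then show ?thesis using quasi_affine_eq[of d a b] by simp
next
  case False
  have "m dvd lin d a x + b \<longleftrightarrow> m dvd lin d a y + b" if "same_cell d {} \<bar>m\<bar> x y" for x y
  proof -
    have "[lin d a x + b = lin d a y + b] (mod m)"
      using that cong_lin[of d x y "m" a] by (auto simp: same_cell_def intro: cong_add)
    then show ?thesis by (rule cong_dvd_iff)
  qed
  then show ?thesis unfolding quasi_affine_def using False
    by (intro exI[of _ "{}"] exI[of _ "\<bar>m\<bar>"]) auto
qed

text \<open>Indices beyond the environment denote unspecified constants, since
  \<open>xs ! n = [] ! (n - length xs)\<close> for \<open>n \<ge> length xs\<close>; so this holds without any
  bound on the variables of \<open>t\<close>.\<close>

lemma Inum_affine: "\<exists>a b. \<forall>x. Inum (map x [0..<d]) t = lin d a x + b"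
proof (induction t)
  case (C c)
  show ?case by (intro exI[of _ "\<lambda>_. 0"] exI[of _ c]) (simp add: lin_def)
next
  case (Bound n)
  show ?case
  proof (cases "n < d")
    case True
    then show ?thesis
      by (intro exI[of _ "\<lambda>i. of_bool (i = n)"] exI[of _ 0]) (simp add: lin_def if_distrib cong: if_cong)
  next
    case False
    have "map x [0..<d] ! n = [] ! (n - d)" for x :: "nat \<Rightarrow> int"
      using nth_append[of "map x [0..<d]" "[]" n] False by simp
    then show ?thesis
      by (intro exI[of _ "\<lambda>_. 0"] exI[of _ "[] ! (n - d)"]) (simp add: lin_def)
  qed
next
  case (CN n c t)
  then obtain a b where ab: "\<And>x. Inum (map x [0..<d]) t = lin d a x + b" by blast
  show ?case
  proof (cases "n < d")
    case True
    then show ?thesis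
      by (intro exI[of _ "\<lambda>i. (if i = n then c else 0) + a i"] exI[of _ b])
        (auto simp: lin_def ab distrib_right sum.distrib if_distrib[of "\<lambda>u. u * _"] cong: if_cong)
  next
    case False
    have "map x [0..<d] ! n = [] ! (n - d)" for x :: "nat \<Rightarrow> int"
      using nth_append[of "map x [0..<d]" "[]" n] False by simp
    then show ?thesis
      by (intro exI[of _ a] exI[of _ "b + c * [] ! (n - d)"]) (simp add: ab)
  qed
next
  case (Neg t)
  then obtain a b where "\<And>x. Inum (map x [0..<d]) t = lin d a x + b" by blast
  then show ?case
    by (intro exI[of _ "\<lambda>i. - a i"] exI[of _ "- b"]) (simp add: lin_def sum_negf)
next
  case (Add s t)
  then obtain a b a' b' where "\<And>x. Inum (map x [0..<d]) s = lin d a x + b"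
    "\<And>x. Inum (map x [0..<d]) t = lin d a' x + b'" by blast
  then show ?case
    by (intro exI[of _ "\<lambda>i. a i + a' i"] exI[of _ "b + b'"])
      (simp add: lin_def distrib_right sum.distrib)
next
  case (Sub s t)
  then obtain a b a' b' where "\<And>x. Inum (map x [0..<d]) s = lin d a x + b"
    "\<And>x. Inum (map x [0..<d]) t = lin d a' x + b'" by blast
  then show ?case
    by (intro exI[of _ "\<lambda>i. a i - a' i"] exI[of _ "b - b'"])
      (simp add: lin_def left_diff_distrib sum_subtractf)
next
  case (Mul c t)
  then obtain a b where "\<And>x. Inum (map x [0..<d]) t = lin d a x + b" by blast
  then show ?case
    by (intro exI[of _ "\<lambda>i. c * a i"] exI[of _ "c * b"])
      (simp add: lin_def sum_distrib_left distrib_left mult.assoc)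
qed

lemma quasi_affine_qfree: "qfree p \<Longrightarrow> quasi_affine d (\<lambda>x. Ifm bbs (map x [0..<d]) p)"
proof (induction p)
  case (Lt t)
  obtain a b where ab: "\<And>x. Inum (map x [0..<d]) t = lin d a x + b" using Inum_affine by blast
  \<comment> \<open>Over the integers a strict inequality is a weak one with the constant moved by
    one.\<close>
  have eq: "Ifm bbs (map x [0..<d]) (Lt t) \<longleftrightarrow> lin d a x + (b + 1) \<le> 0" for x by (auto simp: ab)
  show ?case unfolding eq by (rule quasi_affine_halfspace)
next
  case (Le t)
  obtain a b where ab: "\<And>x. Inum (map x [0..<d]) t = lin d a x + b" using Inum_affine by blast
  show ?case unfolding Ifm.simps ab by (rule quasi_affine_halfspace)
next
  case (Gt t)
  obtain a b where ab: "\<And>x. Inum (map x [0..<d]) t = lin d a x + b" using Inum_affine by blast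
  have eq: "Ifm bbs (map x [0..<d]) (Gt t) \<longleftrightarrow> \<not> lin d a x + b \<le> 0" for x by (auto simp: ab)
  show ?case unfolding eq by (rule quasi_affine_map[OF quasi_affine_halfspace])
next
  case (Ge t)
  obtain a b where ab: "\<And>x. Inum (map x [0..<d]) t = lin d a x + b" using Inum_affine by blast
  have eq: "Ifm bbs (map x [0..<d]) (Ge t) \<longleftrightarrow> \<not> lin d a x + (b + 1) \<le> 0" for x by (auto simp: ab)
  show ?case unfolding eq by (rule quasi_affine_map[OF quasi_affine_halfspace])
next
  case (Eq t)
  obtain a b where ab: "\<And>x. Inum (map x [0..<d]) t = lin d a x + b" using Inum_affine by blast
  show ?case unfolding Ifm.simps ab by (rule quasi_affine_eq)
next
  case (NEq t)
  obtain a b where ab: "\<And>x. Inum (map x [0..<d]) t = lin d a x + b" using Inum_affine by blast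
  show ?case unfolding Ifm.simps ab by (rule quasi_affine_map[OF quasi_affine_eq])
next
  case (Dvd m t)
  obtain a b where ab: "\<And>x. Inum (map x [0..<d]) t = lin d a x + b" using Inum_affine by blast
  show ?case unfolding Ifm.simps ab by (rule quasi_affine_dvd)
next
  case (NDvd m t)
  obtain a b where ab: "\<And>x. Inum (map x [0..<d]) t = lin d a x + b" using Inum_affine by blast
  show ?case unfolding Ifm.simps ab by (rule quasi_affine_map[OF quasi_affine_dvd])
\<comment> \<open>\<open>Closed\<close> and \<open>NClosed\<close> depend on \<open>bbs\<close>
  only, hence are constant in \<open>x\<close>.\<close>
qed (auto intro: quasi_affine_const quasi_affine_map quasi_affine_combine)

text \<open>Cooper's procedure \<open>pa\<close> returns an equivalent quantifier-free formula, to
  which the preceding lemma applies.\<close>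

lemma quasi_affine_holds: "quasi_affine d (\<lambda>x. holds (map x [0..<d]) p)"
  using quasi_affine_qfree[of "pa (cooper_fm p)" d "[]"]
  by (simp add: mirqe Ifm_cooper_fm)

hide_const (open) C Bound CN num.Neg Add Sub Mul
  T F Lt Le Gt Ge Eq NEq Dvd NDvd fm.Not And Or Imp Iff E A Closed NClosed

section \<open>Definable predicates and functions\<close>

text \<open>Definability is handled for predicates on coordinate functions, where renaming and
  shifting are easy; \<open>presburger_definable_iff\<close> translates back to sets of
  lists.\<close>

definition definable :: "nat \<Rightarrow> ((nat \<Rightarrow> int) \<Rightarrow> bool) \<Rightarrow> bool" where
  "definable d P \<longleftrightarrow> (\<exists>p. free_vars_below d p \<and> (\<forall>x. holds (map x [0..<d]) p \<longleftrightarrow> P x))"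

lemma definableI:
  "free_vars_below d p \<Longrightarrow> (\<And>x. holds (map x [0..<d]) p \<longleftrightarrow> P x) \<Longrightarrow> definable d P"
  unfolding definable_def by blast

lemma definableE:
  assumes "definable d P"
  obtains p where "free_vars_below d p" "P = (\<lambda>x. holds (map x [0..<d]) p)"
  using assms unfolding definable_def by fastforce

lemma quasi_affine_definable: "definable d P \<Longrightarrow> quasi_affine d P"
  by (auto elim!: definableE intro: quasi_affine_holds)

lemma definable_local:
  assumes "definable d P" "\<And>i. i < d \<Longrightarrow> x i = y i"
  shows "P x = P y"
proof -
  have "map x [0..<d] = map y [0..<d]" using assms(2) by simp
  then show ?thesis using assms(1) by (metis definableE)
qed

lemma definable_not: "definable d P \<Longrightarrow> definable d (\<lambda>x. \<not> P x)"
  by (elim definableE, rule definableI[of _ "pform.Neg p" for p]) auto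

lemma definable_conj: "definable d P \<Longrightarrow> definable d Q \<Longrightarrow> definable d (\<lambda>x. P x \<and> Q x)"
  by (elim definableE, rule definableI[of _ "Conj p q" for p q]) auto

lemma definable_disj: "definable d P \<Longrightarrow> definable d Q \<Longrightarrow> definable d (\<lambda>x. P x \<or> Q x)"
  by (elim definableE, rule definableI[of _ "Disj p q" for p q]) auto

lemma definable_imp: "definable d P \<Longrightarrow> definable d Q \<Longrightarrow> definable d (\<lambda>x. P x \<longrightarrow> Q x)"
  by (elim definableE, rule definableI[of _ "Impl p q" for p q]) auto

lemma map_case_nat: "map (case_nat a x) [0..<Suc d] = a # map x [0..<d]"
  by (simp add: map_upt_Suc del: upt_Suc)

text \<open>\<open>case_nat a x\<close> puts the bound value in front, at de Bruijn index 0.\<close>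

lemma definable_ex: "definable (Suc d) P \<Longrightarrow> definable d (\<lambda>x. \<exists>a. P (case_nat a x))"
  by (elim definableE, rule definableI[of _ "Exists p" for p])
     (auto simp: map_case_nat simp del: upt_Suc)

lemma definable_all: "definable (Suc d) P \<Longrightarrow> definable d (\<lambda>x. \<forall>a. P (case_nat a x))"
  using definable_not[OF definable_ex[OF definable_not]] by simp

lemma definable_True: "definable d (\<lambda>x. True)"
proof -
  \<comment> \<open>For \<open>d = 0\<close> there is no free variable to build an atom from, so a
    quantifier supplies one.\<close>
  let ?p = "Exists (Equal (Var 0) (Var 0))"
  have "free_vars_below d ?p" "\<forall>x. holds (map x [0..<d]) ?p \<longleftrightarrow> True" by auto
  then show ?thesis unfolding definable_def by blast
qed

lemma definable_const: "definable d (\<lambda>x. c)"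
  using definable_True[of d] definable_not[OF definable_True[of d]] by (cases c) auto

lemma definable_finite_ex:
  "finite I \<Longrightarrow> (\<And>i. i \<in> I \<Longrightarrow> definable d (P i)) \<Longrightarrow> definable d (\<lambda>x. \<exists>i\<in>I. P i x)"
  by (induction I rule: finite_induct) (auto intro: definable_const definable_disj)

lemma definable_finite_all:
  "finite I \<Longrightarrow> (\<And>i. i \<in> I \<Longrightarrow> definable d (P i)) \<Longrightarrow> definable d (\<lambda>x. \<forall>i\<in>I. P i x)"
  by (induction I rule: finite_induct) (auto intro: definable_const definable_conj)

section \<open>Renaming of variables\<close>

primrec rename_term :: "(nat \<Rightarrow> nat) \<Rightarrow> pterm \<Rightarrow> pterm" where
  "rename_term r (Var i) = Var (r i)"
| "rename_term r (Plus s t) = Plus (rename_term r s) (rename_term r t)"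

text \<open>Below a quantifier, index 0 is the bound variable and stays fixed, while all others move
  up by one.\<close>

abbreviation lift_renaming :: "(nat \<Rightarrow> nat) \<Rightarrow> nat \<Rightarrow> nat" where
  "lift_renaming r \<equiv> case_nat 0 (\<lambda>i. Suc (r i))"

primrec rename :: "(nat \<Rightarrow> nat) \<Rightarrow> pform \<Rightarrow> pform" where
  "rename r (Less s t) = Less (rename_term r s) (rename_term r t)"
| "rename r (Equal s t) = Equal (rename_term r s) (rename_term r t)"
| "rename r (pform.Neg p) = pform.Neg (rename r p)"
| "rename r (Conj p q) = Conj (rename r p) (rename r q)"
| "rename r (Disj p q) = Disj (rename r p) (rename r q)"
| "rename r (Impl p q) = Impl (rename r p) (rename r q)"
| "rename r (Exists p) = Exists (rename (lift_renaming r) p)"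
| "rename r (Forall p) = Forall (rename (lift_renaming r) p)"

lemma term_vars_below_rename:
  "term_vars_below k t \<Longrightarrow> (\<And>i. i < k \<Longrightarrow> r i < m) \<Longrightarrow> term_vars_below m (rename_term r t)"
  by (induction t) auto

lemma term_val_rename:
  "term_vars_below k t \<Longrightarrow> (\<And>i. i < k \<Longrightarrow> r i < m) \<Longrightarrow>
    term_val (map x [0..<m]) (rename_term r t) = term_val (map (\<lambda>i. x (r i)) [0..<k]) t"
  by (induction t) auto

lemma free_vars_below_rename:
  "free_vars_below k p \<Longrightarrow> (\<And>i. i < k \<Longrightarrow> r i < m) \<Longrightarrow> free_vars_below m (rename r p)"
proof (induction p arbitrary: k m r)
  case (Exists p)
  then show ?case by (auto intro!: Exists.IH[of "Suc k"] simp: less_Suc_eq_0_disj)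
next
  case (Forall p)
  then show ?case by (auto intro!: Forall.IH[of "Suc k"] simp: less_Suc_eq_0_disj)
qed (auto intro: term_vars_below_rename)

lemma holds_rename:
  "free_vars_below k p \<Longrightarrow> (\<And>i. i < k \<Longrightarrow> r i < m) \<Longrightarrow>
    holds (map x [0..<m]) (rename r p) \<longleftrightarrow> holds (map (\<lambda>i. x (r i)) [0..<k]) p"
proof (induction p arbitrary: k m r x)
  case (Exists p)
  have "holds (map (case_nat a x) [0..<Suc m]) (rename (lift_renaming r) p) \<longleftrightarrow>
      holds (map (\<lambda>i. case_nat a x (lift_renaming r i)) [0..<Suc k]) p" for a
    using Exists.prems by (intro Exists.IH) (auto simp: less_Suc_eq_0_disj)
  moreover have "(\<lambda>i. case_nat a x (lift_renaming r i)) = case_nat a (\<lambda>i. x (r i))" for a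
    by (auto split: nat.split)
  ultimately show ?case by (simp add: map_case_nat del: upt_Suc)
next
  case (Forall p)
  have "holds (map (case_nat a x) [0..<Suc m]) (rename (lift_renaming r) p) \<longleftrightarrow>
      holds (map (\<lambda>i. case_nat a x (lift_renaming r i)) [0..<Suc k]) p" for a
    using Forall.prems by (intro Forall.IH) (auto simp: less_Suc_eq_0_disj)
  moreover have "(\<lambda>i. case_nat a x (lift_renaming r i)) = case_nat a (\<lambda>i. x (r i))" for a
    by (auto split: nat.split)
  ultimately show ?case by (simp add: map_case_nat del: upt_Suc)
qed (auto simp: term_val_rename)

lemma definable_rename:
  assumes "definable k P" "\<And>i. i < k \<Longrightarrow> r i < m"
  shows "definable m (\<lambda>x. P (\<lambda>i. x (r i)))"
  using assms(1)
proof (rule definableE)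
  fix p assume p: "free_vars_below k p" "P = (\<lambda>x. holds (map x [0..<k]) p)"
  show ?thesis
    using free_vars_below_rename[OF p(1) assms(2)] holds_rename[OF p(1) assms(2)] p(2)
    by (intro definableI[of _ "rename r p"]) auto
qed

section \<open>Definable functions and substitution\<close>

definition definable_fun :: "nat \<Rightarrow> ((nat \<Rightarrow> int) \<Rightarrow> int) \<Rightarrow> bool" where
  "definable_fun d g \<longleftrightarrow> definable (Suc d) (\<lambda>x. x 0 = g (\<lambda>i. x (Suc i)))"

text \<open>Binds a block of \<open>k\<close> variables at once; the block comes first and the
  \<open>d\<close> remaining variables follow, shifted by \<open>k\<close>.\<close>

lemma definable_ex_prefix:
  "definable (k + d) Q \<Longrightarrow>
    definable d (\<lambda>x. \<exists>y. Q (\<lambda>i. if i < k then y i else x (i - k)))"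
proof (induction k arbitrary: Q)
  case 0
  then show ?case by simp
next
  case (Suc k)
  have "definable (k + d) (\<lambda>x. \<exists>a. Q (case_nat a x))"
    using Suc.prems by (intro definable_ex) simp
  from Suc.IH[OF this] have
    "definable d (\<lambda>x. \<exists>y a. Q (case_nat a (\<lambda>i. if i < k then y i else x (i - k))))" .
  moreover have "(\<exists>y a. Q (case_nat a (\<lambda>i. if i < k then y i else x (i - k)))) \<longleftrightarrow>
      (\<exists>y. Q (\<lambda>i. if i < Suc k then y i else x (i - Suc k)))" for x
  proof -
    have split: "(\<lambda>i. if i < Suc k then y i else x (i - Suc k)) =
      case_nat (y 0) (\<lambda>i. if i < k then y (Suc i) else x (i - k))" for y
      by (auto split: nat.split)
    show ?thesis unfolding split
    proof
      assume "\<exists>y a. Q (case_nat a (\<lambda>i. if i < k then y i else x (i - k)))"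
      then obtain y a where "Q (case_nat a (\<lambda>i. if i < k then y i else x (i - k)))" by blast
      then show "\<exists>y. Q (case_nat (y 0) (\<lambda>i. if i < k then y (Suc i) else x (i - k)))"
        by (intro exI[of _ "case_nat a y"]) (simp cong: if_cong)
    next
      assume "\<exists>y. Q (case_nat (y 0) (\<lambda>i. if i < k then y (Suc i) else x (i - k)))"
      then obtain y where "Q (case_nat (y 0) (\<lambda>i. if i < k then y (Suc i) else x (i - k)))" ..
      then show "\<exists>y a. Q (case_nat a (\<lambda>i. if i < k then y i else x (i - k)))"
        by (intro exI[of _ "\<lambda>i. y (Suc i)"] exI[of _ "y 0"])
    qed
  qed
  ultimately show ?case by simp
qed

text \<open>\<open>P\<close> holds at the tuple of values iff there are \<open>k\<close> numbers
  satisfying \<open>P\<close> that lie on the graphs of the \<open>g i\<close>.\<close>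

lemma definable_subst:
  assumes P: "definable k P" and g: "\<And>i. i < k \<Longrightarrow> definable_fun d (g i)"
  shows "definable d (\<lambda>x. P (\<lambda>i. g i x))"
proof -
  have "definable (k + d) (\<lambda>x. P x \<and> (\<forall>i\<in>{..<k}. x i = g i (\<lambda>j. x (k + j))))"
  proof (intro definable_conj definable_finite_all)
    show "definable (k + d) P"
      using definable_rename[OF P, of "\<lambda>i. i" "k + d"] by simp
    fix i assume "i \<in> {..<k}"
    then have "i < k" by simp
    then have "case_nat i (\<lambda>j. k + j) l < k + d" if "l < Suc d" for l
      using that by (auto split: nat.split)
    from definable_rename[OF g[OF \<open>i < k\<close>, unfolded definable_fun_def], of "case_nat i (\<lambda>j. k + j)", OF this]
    show "definable (k + d) (\<lambda>x. x i = g i (\<lambda>j. x (k + j)))" by simp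
  qed simp
  from definable_ex_prefix[OF this]
  have "definable d (\<lambda>x. \<exists>y. P (\<lambda>i. if i < k then y i else x (i - k)) \<and> (\<forall>i<k. y i = g i x))"
    by (simp add: Ball_def)
  moreover have "(\<exists>y. P (\<lambda>i. if i < k then y i else x (i - k)) \<and> (\<forall>i<k. y i = g i x)) \<longleftrightarrow>
      P (\<lambda>i. g i x)" for x
  proof -
    \<comment> \<open>The equations fix \<open>y\<close> only below \<open>k\<close>;
      \<open>definable_local\<close> says that \<open>P\<close> sees no more than that.\<close>
    have "P (\<lambda>i. if i < k then y i else x (i - k)) = P (\<lambda>i. g i x)" if "\<forall>i<k. y i = g i x" for y
      using that by (intro definable_local[OF P]) auto
    then show ?thesis by (metis (no_types, lifting))
  qed
  ultimately show ?thesis by simp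
qed

lemma definable_Var_less: "i < d \<Longrightarrow> j < d \<Longrightarrow> definable d (\<lambda>x. x i < x j)"
  unfolding definable_def by (intro exI[of _ "Less (Var i) (Var j)"]) auto

lemma definable_Var_sum: "i < d \<Longrightarrow> j < d \<Longrightarrow> k < d \<Longrightarrow> definable d (\<lambda>x. x i = x j + x k)"
  unfolding definable_def by (intro exI[of _ "Equal (Var i) (Plus (Var j) (Var k))"]) auto

lemma definable_fun_var: "i < d \<Longrightarrow> definable_fun d (\<lambda>x. x i)"
  unfolding definable_fun_def definable_def by (intro exI[of _ "Equal (Var 0) (Var (Suc i))"]) (auto simp del: upt_Suc)

lemma definable_fun_zero: "definable_fun d (\<lambda>x. 0)"
  using definable_Var_sum[of 0 "Suc d" 0 0] by (simp add: definable_fun_def)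

lemma definable_fun_graph3:
  assumes "definable 3 (\<lambda>x. x 0 = F (x 1) (x 2))" "definable_fun d g" "definable_fun d h"
  shows "definable_fun d (\<lambda>x. F (g x) (h x))"
proof -
  have shift: "definable_fun (Suc d) (\<lambda>x. g (\<lambda>i. x (Suc i)))" if "definable_fun d g" for g
    using definable_rename[OF that[unfolded definable_fun_def], of "case_nat 0 (\<lambda>i. Suc (Suc i))" "Suc (Suc d)"]
    by (simp add: definable_fun_def split: nat.split)
  have "definable (Suc d) (\<lambda>x. (\<lambda>y. y 0 = F (y 1) (y 2))
      (\<lambda>i. ([\<lambda>x. x 0, \<lambda>x. g (\<lambda>i. x (Suc i)), \<lambda>x. h (\<lambda>i. x (Suc i))] ! i) x))"
  proof (rule definable_subst[OF assms(1)])
    fix i :: nat assume "i < 3"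
    then consider "i = 0" | "i = 1" | "i = 2" by linarith
    then show "definable_fun (Suc d) ([\<lambda>x. x 0, \<lambda>x. g (\<lambda>i. x (Suc i)), \<lambda>x. h (\<lambda>i. x (Suc i))] ! i)"
      by cases (auto intro: shift assms definable_fun_var)
  qed
  then show ?thesis by (simp add: definable_fun_def)
qed

lemma definable_fun_add:
  "definable_fun d g \<Longrightarrow> definable_fun d h \<Longrightarrow> definable_fun d (\<lambda>x. g x + h x)"
  by (rule definable_fun_graph3[of "(+)"]) (auto intro: definable_Var_sum)

lemma definable_fun_diff:
  assumes "definable_fun d g" "definable_fun d h"
  shows "definable_fun d (\<lambda>x. g x - h x)"
proof -
  have "definable 3 (\<lambda>x. x 1 = x 0 + x 2)" by (rule definable_Var_sum) auto
  \<comment> \<open>The graph of subtraction is the graph of addition with the roles of the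
    variables exchanged.\<close>
  then have "definable 3 (\<lambda>x. x 0 = x 1 - x 2)" by (simp add: eq_diff_eq eq_commute)
  then show ?thesis by (rule definable_fun_graph3) (use assms in auto)
qed

lemma definable_less:
  assumes "definable_fun d g" "definable_fun d h"
  shows "definable d (\<lambda>x. g x < h x)"
proof -
  have "definable d (\<lambda>x. (\<lambda>y. y 0 < y 1) (\<lambda>i. ([g, h] ! i) x))"
    by (rule definable_subst[OF definable_Var_less[of 0 2 1]])
      (auto simp: assms less_2_cases_iff)
  then show ?thesis by simp
qed

lemma definable_le:
  "definable_fun d g \<Longrightarrow> definable_fun d h \<Longrightarrow> definable d (\<lambda>x. g x \<le> h x)"
  using definable_not[OF definable_less[of d h g]] by (simp add: not_less)

lemma definable_eq:
  assumes "definable_fun d g" "definable_fun d h"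
  shows "definable d (\<lambda>x. g x = h x)"
  using definable_conj[OF definable_le[OF assms] definable_le[OF assms(2,1)]]
  by (simp add: order_eq_iff)

text \<open>The language has no constants: 0 was obtained from \<open>z = z + z\<close>, and 1 is
  the least positive integer.\<close>

lemma definable_fun_one: "definable_fun d (\<lambda>x. 1)"
proof -
  have "definable (Suc (Suc d)) (\<lambda>x. (\<lambda>_. 0) x < x 0 \<longrightarrow> x (Suc 0) \<le> x 0)"
    by (intro definable_imp definable_less definable_le definable_fun_var definable_fun_zero) auto
  from definable_all[OF this]
  have "definable (Suc d) (\<lambda>x. \<forall>a>0. x 0 \<le> a)" by simp
  then have "definable (Suc d) (\<lambda>x. 0 < x 0 \<and> (\<forall>a>0. x 0 \<le> a))"
    by (intro definable_conj definable_less[of _ "\<lambda>_. 0"] definable_fun_var definable_fun_zero) auto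
  moreover have "0 < c \<and> (\<forall>a>0. c \<le> a) \<longleftrightarrow> c = 1" for c :: int
    by (metis int_one_le_iff_zero_less order_antisym zero_less_one)
  ultimately show ?thesis by (simp add: definable_fun_def)
qed

lemma definable_fun_scale:
  assumes "definable_fun d g"
  shows "definable_fun d (\<lambda>x. c * g x)"
proof (induction c rule: int_induct[where k=0])
  case base
  then show ?case by (simp add: definable_fun_zero)
next
  case (step1 i)
  then show ?case using definable_fun_add[OF _ assms] by (simp add: distrib_right)
next
  case (step2 i)
  then show ?case using definable_fun_diff[OF _ assms] by (simp add: left_diff_distrib)
qed

lemma definable_fun_const: "definable_fun d (\<lambda>x. c)"
  using definable_fun_scale[OF definable_fun_one, of d c] by simp

lemmas definable_fun_intros =
  definable_fun_add definable_fun_diff definable_fun_scale definable_fun_const definable_fun_var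

lemma presburger_definable_iff:
  "presburger_definable d M \<longleftrightarrow> M \<subseteq> int_vecs d \<and> definable d (\<lambda>x. map x [0..<d] \<in> M)"
proof
  assume "presburger_definable d M"
  then show "M \<subseteq> int_vecs d \<and> definable d (\<lambda>x. map x [0..<d] \<in> M)"
    unfolding presburger_definable_def definable_def by (auto simp: int_vecs_def)
next
  assume M: "M \<subseteq> int_vecs d \<and> definable d (\<lambda>x. map x [0..<d] \<in> M)"
  then obtain p where p: "free_vars_below d p" "\<And>x. holds (map x [0..<d]) p \<longleftrightarrow> map x [0..<d] \<in> M"
    unfolding definable_def by blast
  have "holds x p \<longleftrightarrow> x \<in> M" if "length x = d" for x
    using p(2)[of "nth x"] that map_nth[of x] by simp
  then have "M = {x \<in> int_vecs d. holds x p}" using M by (auto simp: int_vecs_def)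
  with p(1) show "presburger_definable d M" unfolding presburger_definable_def by blast
qed

section \<open>Laurent polynomials acting on functions\<close>

text \<open>The group ring of integer exponent vectors: exponents add pointwise and the product of
  finitely supported coefficient functions is convolution.\<close>

type_synonym laurent = "(nat \<Rightarrow> int) \<Rightarrow>\<^sub>0 int"

abbreviation mon :: "(nat \<Rightarrow> int) \<Rightarrow> int \<Rightarrow> laurent" where
  "mon \<equiv> Poly_Mapping.single"

text \<open>The monomial with exponent \<open>v\<close> acts as the shift by \<open>v\<close>;
  \<open>act_mult\<close> shows that functions become a module over \<open>laurent\<close>.\<close>

definition act :: "laurent \<Rightarrow> ((nat \<Rightarrow> int) \<Rightarrow> int) \<Rightarrow> (nat \<Rightarrow> int) \<Rightarrow> int" where
  "act P f x = (\<Sum>v\<in>Poly_Mapping.keys P. Poly_Mapping.lookup P v * f (x + v))"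

lemma act_superset:
  "finite S \<Longrightarrow> Poly_Mapping.keys P \<subseteq> S \<Longrightarrow> act P f x = (\<Sum>v\<in>S. Poly_Mapping.lookup P v * f (x + v))"
  unfolding act_def by (rule sum.mono_neutral_left) (auto simp: in_keys_iff)

lemma act_add: "act (P + R) f x = act P f x + act R f x"
proof -
  let ?S = "Poly_Mapping.keys P \<union> Poly_Mapping.keys R"
  have "act (P + R) f x = (\<Sum>v\<in>?S. Poly_Mapping.lookup (P + R) v * f (x + v))"
    using keys_add[of P R] by (intro act_superset) auto
  also have "\<dots> = (\<Sum>v\<in>?S. Poly_Mapping.lookup P v * f (x + v)) + (\<Sum>v\<in>?S. Poly_Mapping.lookup R v * f (x + v))"
    by (simp add: lookup_add distrib_right sum.distrib)
  also have "\<dots> = act P f x + act R f x"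
    by (simp add: act_superset[of ?S])
  finally show ?thesis .
qed

lemma act_zero: "act 0 f x = 0"
  by (simp add: act_def)

lemma act_diff: "act (P - R) f x = act P f x - act R f x"
  using act_add[of "P - R" R f x] by simp

lemma act_single: "act (mon v c) f x = c * f (x + v)"
  by (subst act_superset[of "{v}"]) auto

lemma act_sum: "act (sum g S) f x = (\<Sum>s\<in>S. act (g s) f x)"
  by (induction S rule: infinite_finite_induct) (auto simp: act_zero act_add)

lemma act_one: "act 1 f = f"
  using act_single[of 0 1 f] by (simp add: fun_eq_iff)

lemma laurent_expand: "P = (\<Sum>v\<in>Poly_Mapping.keys P. mon v (Poly_Mapping.lookup P v))" for P :: laurent
proof (rule poly_mapping_eqI)
  fix k
  show "Poly_Mapping.lookup P k = Poly_Mapping.lookup (\<Sum>v\<in>Poly_Mapping.keys P. mon v (Poly_Mapping.lookup P v)) k"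
    by (simp add: lookup_sum lookup_single when_def in_keys_iff)
qed

lemma act_single_mult: "act (mon v c * P) f x = c * act P f (x + v)"
proof -
  have "mon v c * P = (\<Sum>w\<in>Poly_Mapping.keys P. mon (v + w) (c * Poly_Mapping.lookup P w))"
    by (subst laurent_expand[of P]) (simp add: sum_distrib_left mult_single)
  then show ?thesis
    by (simp add: act_sum act_single) (simp add: act_def sum_distrib_left add.assoc mult.assoc)
qed

lemma act_mult: "act (P * R) f x = act P (act R f) x"
proof -
  have "P * R = (\<Sum>v\<in>Poly_Mapping.keys P. mon v (Poly_Mapping.lookup P v) * R)"
    by (subst laurent_expand[of P]) (simp add: sum_distrib_right)
  then show ?thesis
    by (simp add: act_sum act_single_mult) (simp add: act_def)
qed

lemma act_commute: "act P (act R f) x = act R (act P f) x"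
  by (simp add: mult.commute flip: act_mult)

section \<open>Annihilators up to bounded support\<close>

definition far_zero :: "nat \<Rightarrow> ((nat \<Rightarrow> int) \<Rightarrow> int) \<Rightarrow> bool" where
  "far_zero d g \<longleftrightarrow> (\<exists>L. \<forall>x. (\<exists>i<d. L \<le> \<bar>x i\<bar>) \<longrightarrow> g x = 0)"

lemma far_zero_lincomb:
  assumes "far_zero d g" "far_zero d h"
  shows "far_zero d (\<lambda>x. a * g x + b * h x)"
proof -
  obtain L L' where "\<And>x i. i < d \<Longrightarrow> L \<le> \<bar>x i\<bar> \<Longrightarrow> g x = 0" "\<And>x i. i < d \<Longrightarrow> L' \<le> \<bar>x i\<bar> \<Longrightarrow> h x = 0"
    using assms unfolding far_zero_def by blast
  then have "\<forall>x. (\<exists>i<d. max L L' \<le> \<bar>x i\<bar>) \<longrightarrow> a * g x + b * h x = 0"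
    by (metis max.boundedE mult_zero_right add_0)
  then show ?thesis unfolding far_zero_def by blast
qed

lemma far_zero_shift:
  assumes "far_zero d g"
  shows "far_zero d (\<lambda>x. g (x + v))"
proof -
  obtain L where L: "\<And>x i. i < d \<Longrightarrow> L \<le> \<bar>x i\<bar> \<Longrightarrow> g x = 0"
    using assms unfolding far_zero_def by blast
  \<comment> \<open>Enlarging the bound by the sum of the \<open>\<bar>v i\<bar>\<close> keeps the
    shifted point outside the old bound.\<close>
  have "g (x + v) = 0" if "i < d" "L + (\<Sum>i<d. \<bar>v i\<bar>) \<le> \<bar>x i\<bar>" for x i
  proof (rule L[OF that(1)])
    have "\<bar>v i\<bar> \<le> (\<Sum>i<d. \<bar>v i\<bar>)" using that(1) by (intro member_le_sum) auto
    then show "L \<le> \<bar>(x + v) i\<bar>" using that(2) by simp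
  qed
  then show ?thesis unfolding far_zero_def by blast
qed

lemma far_zero_0: "far_zero d (\<lambda>x. 0)"
  by (simp add: far_zero_def)

lemma far_zero_sum:
  "(\<And>s. s \<in> S \<Longrightarrow> far_zero d (g s)) \<Longrightarrow> far_zero d (\<lambda>x. \<Sum>s\<in>S. c s * g s x)"
proof (induction S rule: infinite_finite_induct)
  case (insert s S)
  then show ?case using far_zero_lincomb[of d "g s" "\<lambda>x. \<Sum>s\<in>S. c s * g s x" "c s" 1] by simp
qed (auto simp: far_zero_0)

lemma far_zero_act: "far_zero d g \<Longrightarrow> far_zero d (act P g)"
  using far_zero_sum[of "Poly_Mapping.keys P" d "\<lambda>v x. g (x + v)" "Poly_Mapping.lookup P"]
  by (simp add: act_def[abs_def] far_zero_shift)

text \<open>By the next two lemmas this set is closed under differences and multiples, as needed for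
  the elimination in \<open>vandermonde_ideal\<close>.\<close>

definition far_annihilators :: "nat \<Rightarrow> ((nat \<Rightarrow> int) \<Rightarrow> int) \<Rightarrow> laurent set" where
  "far_annihilators d f = {P. far_zero d (act P f)}"

lemma far_annihilators_diff:
  assumes "P \<in> far_annihilators d f" "R \<in> far_annihilators d f"
  shows "P - R \<in> far_annihilators d f"
  using assms far_zero_lincomb[of d "act P f" "act R f" 1 "-1"]
  by (simp add: far_annihilators_def act_diff[abs_def])

lemma far_annihilators_mult:
  "P \<in> far_annihilators d f \<Longrightarrow> R * P \<in> far_annihilators d f"
  by (simp add: far_annihilators_def act_mult[abs_def] far_zero_act)

text \<open>Vandermonde elimination without division. Subtracting \<open>u l\<close> times the sum
  with exponent \<open>j\<close> from the sum with exponent \<open>Suc j\<close> removes the term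
  \<open>l\<close> and multiplies every other coefficient \<open>b i\<close> by
  \<open>u i - u l\<close>; repeating this leaves the term \<open>k\<close> alone.\<close>

lemma vandermonde_ideal:
  fixes u :: "'b \<Rightarrow> 'a::comm_ring_1"
  assumes diff: "\<And>x y. x \<in> I \<Longrightarrow> y \<in> I \<Longrightarrow> x - y \<in> I"
    and mult: "\<And>r x. x \<in> I \<Longrightarrow> r * x \<in> I"
    and "finite S" "k \<notin> S" "\<And>j. (\<Sum>i\<in>insert k S. b i * u i ^ j) \<in> I"
  shows "b k * (\<Prod>i\<in>S. u k - u i) \<in> I"
  using assms(3-)
proof (induction S arbitrary: b rule: finite_induct)
  case empty
  from empty(2)[of 0] show ?case by simp
next
  case (insert l S)
  have "(\<Sum>i\<in>insert k S. (b i * (u i - u l)) * u i ^ j) \<in> I" for j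
  proof -
    have "(\<Sum>i\<in>insert k (insert l S). b i * u i ^ Suc j)
        - u l * (\<Sum>i\<in>insert k (insert l S). b i * u i ^ j)
      = (\<Sum>i\<in>insert k (insert l S). (b i * (u i - u l)) * u i ^ j)"
      by (simp only: sum_distrib_left sum_subtractf[symmetric])
        (rule sum.cong; simp add: algebra_simps)
    also have "\<dots> = (\<Sum>i\<in>insert k S. (b i * (u i - u l)) * u i ^ j)"
      using insert.hyps insert.prems(1) by (intro sum.mono_neutral_right) auto
    finally show ?thesis
      by (rule subst[where P="\<lambda>z. z \<in> I"]) (intro diff mult insert.prems(2))
  qed
  from insert.IH[OF _ this] insert.prems(1) insert.hyps show ?case
    by (simp add: mult.assoc)
qed

section \<open>Congruences modulo a prime\<close>

lemma freshman_dvd: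
  fixes a b :: "'a::comm_ring_1"
  assumes "prime p"
  shows "of_nat p dvd (a + b) ^ p - (a ^ p + b ^ p)"
proof -
  let ?t = "\<lambda>k. of_nat (p choose k) * a ^ k * b ^ (p - k)"
  have p: "p > 0" using assms prime_gt_0_nat by blast
  have "{..p} = insert 0 (insert p {0<..<p})" using p by auto
  then have "(a + b) ^ p = ?t 0 + (?t p + sum ?t {0<..<p})"
    using p by (simp add: binomial_ring)
  then have "(a + b) ^ p - (a ^ p + b ^ p) = sum ?t {0<..<p}" by simp
  moreover have "of_nat p dvd ?t k" if "k \<in> {0<..<p}" for k
  proof -
    have "p dvd p choose k" using that assms by (intro dvd_choose_prime) auto
    then obtain r where "p choose k = p * r" by blast
    then show ?thesis by (simp add: mult.assoc)
  qed
  ultimately show ?thesis by (auto intro!: dvd_sum)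
qed

lemma freshman_sum_dvd:
  fixes g :: "'b \<Rightarrow> 'a::comm_ring_1"
  assumes "prime p"
  shows "of_nat p dvd (\<Sum>s\<in>S. g s) ^ p - (\<Sum>s\<in>S. g s ^ p)"
proof (induction S rule: infinite_finite_induct)
  case (insert s S)
  have "(\<Sum>s\<in>insert s S. g s) ^ p - (\<Sum>s\<in>insert s S. g s ^ p) =
     ((g s + sum g S) ^ p - (g s ^ p + sum g S ^ p)) + (sum g S ^ p - (\<Sum>s\<in>S. g s ^ p))"
    using insert.hyps by simp
  then show ?case using freshman_dvd[OF assms] insert.IH by (metis dvd_add)
qed (use assms prime_gt_0_nat in \<open>auto simp: power_0_left\<close>)

text \<open>Up to congruence \<open>c\<close> is a sum of \<open>n\<close> ones, so that the
  additivity of the \<open>p\<close>-th power modulo \<open>p\<close> applies.\<close>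

lemma fermat_dvd:
  fixes c :: int
  assumes "prime p"
  shows "int p dvd c ^ p - c"
proof -
  define n where "n = nat (c mod int p)"
  have p: "p > 0" using assms prime_gt_0_nat by blast
  have "int p dvd int n ^ p - int n"
    using freshman_sum_dvd[OF assms, of "\<lambda>_. 1 :: int" "{..<n}"] by simp
  then have "[int n ^ p = int n] (mod int p)" by (simp add: cong_iff_dvd_diff)
  moreover have "[c = int n] (mod int p)" using p by (simp add: n_def)
  ultimately have "[c ^ p = c] (mod int p)"
    by (meson cong_pow cong_sym cong_trans)
  then show ?thesis by (simp add: cong_iff_dvd_diff)
qed

definition scale :: "nat \<Rightarrow> (nat \<Rightarrow> int) \<Rightarrow> nat \<Rightarrow> int" where
  "scale n a = (\<lambda>i. int n * a i)"

lemma single_power: "mon a c ^ n = mon (scale n a) (c ^ n)" for c :: int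
proof (induction n)
  case 0
  have "scale 0 a = 0" by (simp add: scale_def fun_eq_iff)
  then show ?case by (simp only: power_0 single_one)
next
  case (Suc n)
  have "a + scale n a = scale (Suc n) a" by (simp add: scale_def fun_eq_iff distrib_right)
  then show ?case using Suc by (simp add: mult_single)
qed

text \<open>The substitution \<open>P(X^n)\<close> in the Laurent polynomial \<open>P\<close> with
  exponents \<open>S\<close> and coefficients \<open>c\<close>.\<close>

definition dilate :: "(nat \<Rightarrow> int) set \<Rightarrow> ((nat \<Rightarrow> int) \<Rightarrow> int) \<Rightarrow> nat \<Rightarrow> laurent" where
  "dilate S c n = (\<Sum>a\<in>S. mon (scale n a) (c a))"

lemma dilate_frobenius:
  assumes "prime p"
  shows "of_nat p dvd dilate S c n ^ p - dilate S c (n * p)"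
proof -
  have sc: "scale p (scale n a) = scale (n * p) a" for a by (simp add: scale_def ac_simps)
  \<comment> \<open>The first bracket is the error of the Frobenius congruence; the second replaces
    each \<open>c a ^ p\<close> by \<open>c a\<close>, which is Fermat's congruence.\<close>
  have eq: "dilate S c n ^ p - dilate S c (n * p) =
      (dilate S c n ^ p - (\<Sum>a\<in>S. mon (scale n a) (c a) ^ p))
      + (\<Sum>a\<in>S. mon (scale (n * p) a) (c a ^ p - c a))"
    by (simp add: single_power sc single_diff sum_subtractf) (simp add: dilate_def)
  have "of_nat p dvd mon v (c a ^ p - c a)" for v a
  proof -
    obtain q where "c a ^ p - c a = int p * q" using fermat_dvd[OF assms] by blast
    then have "mon v (c a ^ p - c a) = of_nat p * mon v q"
      by (simp only: mult_single add_0 flip: single_of_nat)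
    then show ?thesis by simp
  qed
  then have "of_nat p dvd (\<Sum>a\<in>S. mon (scale (n * p) a) (c a ^ p - c a))"
    by (intro dvd_sum)
  moreover have "of_nat p dvd dilate S c n ^ p - (\<Sum>a\<in>S. mon (scale n a) (c a) ^ p)"
    unfolding dilate_def by (rule freshman_sum_dvd[OF assms])
  ultimately show ?thesis
    unfolding eq by (intro dvd_add)
qed

text \<open>Far out the \<open>p\<close>-th power of \<open>P(X^n)\<close> kills \<open>f\<close>,
  so the value of \<open>P(X^(n p)) f\<close> is a multiple of \<open>p\<close>. Its absolute value
  is at most the coefficient sum times \<open>B\<close>, which is below \<open>p\<close>; so it is
  0.\<close>

lemma dilate_prime:
  assumes bdd: "\<And>x. \<bar>f x\<bar> \<le> B"
    and ann: "dilate S c n \<in> far_annihilators d f"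
    and p: "prime p" "(\<Sum>a\<in>S. \<bar>c a\<bar>) * B < int p"
  shows "dilate S c (n * p) \<in> far_annihilators d f"
proof -
  obtain R where R: "dilate S c n ^ p - dilate S c (n * p) = of_nat p * R"
    using dilate_frobenius[OF p(1)] by blast
  have "dilate S c n ^ p = dilate S c n ^ (p - 1) * dilate S c n"
    using prime_gt_0_nat[OF p(1)] by (simp flip: power_Suc2)
  then have "dilate S c n ^ p \<in> far_annihilators d f"
    using far_annihilators_mult[OF ann] by simp
  then obtain L where L: "\<And>x. \<exists>i<d. L \<le> \<bar>x i\<bar> \<Longrightarrow> act (dilate S c n ^ p) f x = 0"
    unfolding far_annihilators_def far_zero_def by blast
  have "act (dilate S c (n * p)) f x = 0" if x: "\<exists>i<d. L \<le> \<bar>x i\<bar>" for x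
  proof -
    have "dilate S c n ^ p = dilate S c (n * p) + mon 0 (int p) * R"
      using R by (simp add: algebra_simps)
    then have "0 = act (dilate S c (n * p)) f x + int p * act R f x"
      using L[OF x] by (simp add: act_add act_single_mult del: single_of_nat)
    then have "int p dvd act (dilate S c (n * p)) f x"
      by (metis dvd_0_right dvd_add_left_iff dvd_triv_left)
    moreover have "\<bar>act (dilate S c (n * p)) f x\<bar> \<le> (\<Sum>a\<in>S. \<bar>c a\<bar> * B)"
      unfolding dilate_def act_sum act_single
      by (rule order_trans[OF sum_abs], rule sum_mono) (auto simp: abs_mult intro!: mult_left_mono bdd)
    ultimately show ?thesis
      using p(2) dvd_imp_le_int[of "act (dilate S c (n * p)) f x" "int p"]
      by (auto simp: sum_distrib_right simp del: sum_abs)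
  qed
  then show ?thesis unfolding far_annihilators_def far_zero_def by blast
qed

text \<open>The prime factors of \<open>m\<close> are introduced one after the other, each being
  large enough for \<open>dilate_prime\<close>.\<close>

lemma dilate_rough:
  assumes bdd: "\<And>x. \<bar>f x\<bar> \<le> B"
    and ann: "dilate S c 1 \<in> far_annihilators d f"
    and "m > 0" "\<And>p. prime p \<Longrightarrow> p dvd m \<Longrightarrow> (\<Sum>a\<in>S. \<bar>c a\<bar>) * B < int p"
  shows "dilate S c m \<in> far_annihilators d f"
  using assms(3,4)
proof (induction m rule: less_induct)
  case (less m)
  show ?case
  proof (cases "m = 1")
    case True
    then show ?thesis using ann by simp
  next
    case False
    then obtain p where p: "prime p" "p dvd m" using prime_factor_nat by blast
    then obtain k where k: "m = k * p" by (metis dvd_def mult.commute)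
    have "dilate S c k \<in> far_annihilators d f"
      using less.prems k prime_gt_1_nat[OF p(1)] by (intro less.IH) auto
    from dilate_prime[OF bdd this p(1) less.prems(2)[OF p]] show ?thesis by (simp add: k)
  qed
qed

text \<open>For \<open>q = K!\<close> no prime up to \<open>K\<close> divides
  \<open>1 + q * j\<close>, so all the dilations by \<open>1 + q * j\<close> annihilate
  \<open>f\<close> far out. Their terms are \<open>c_a X^a\<close> times the \<open>j\<close>-th
  power of \<open>X^(q a)\<close>, which is the input of \<open>vandermonde_ideal\<close>.\<close>

lemma far_zero_difference_product:
  assumes S: "finite S" "a0 \<notin> S" and c0: "c a0 \<noteq> 0"
    and bdd: "\<And>x. \<bar>f x\<bar> \<le> B"
    and ann: "far_zero d (\<lambda>x. \<Sum>a\<in>insert a0 S. c a * f (x + a))"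
  shows "\<exists>q>0. far_zero d (act (\<Prod>a\<in>S. mon (scale q a0) 1 - mon (scale q a) 1) f)"
proof -
  let ?S = "insert a0 S" and ?I = "far_annihilators d f"
  define K where "K = nat ((\<Sum>a\<in>?S. \<bar>c a\<bar>) * B)"
  define q :: nat where "q = fact K"
  have "scale 1 a = a" for a by (simp add: scale_def)
  then have ann1: "dilate ?S c 1 \<in> ?I"
    using ann unfolding far_annihilators_def dilate_def by (simp only: act_sum[abs_def] act_single mem_Collect_eq)
  have "dilate ?S c (1 + q * j) \<in> ?I" for j
  proof (rule dilate_rough[OF bdd ann1])
    fix p assume p: "prime p" "p dvd 1 + q * j"
    have "\<not> p dvd q * j"
    proof
      assume "p dvd q * j"
      then have "p dvd 1" using p(2) by (metis dvd_add_left_iff)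
      then show False using p(1) by simp
    qed
    then have "\<not> p dvd fact K" by (auto simp: q_def)
    then have "K < p" using p(1) by (simp add: prime_dvd_fact_iff)
    then show "(\<Sum>a\<in>?S. \<bar>c a\<bar>) * B < int p" by (simp add: K_def)
  qed simp
  moreover have "mon (scale (1 + q * j) a) (c a) = mon a (c a) * mon (scale q a) 1 ^ j" for a j
  proof -
    have "scale (1 + q * j) a = a + scale j (scale q a)"
      by (simp add: scale_def fun_eq_iff algebra_simps)
    then show ?thesis by (simp add: single_power mult_single)
  qed
  ultimately have "(\<Sum>a\<in>?S. mon a (c a) * mon (scale q a) 1 ^ j) \<in> ?I" for j
    by (simp add: dilate_def)
  then have "mon a0 (c a0) * (\<Prod>a\<in>S. mon (scale q a0) 1 - mon (scale q a) 1) \<in> ?I"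
    by (intro vandermonde_ideal[where I="?I"] far_annihilators_diff far_annihilators_mult S)
  then have "far_zero d (\<lambda>x. c a0 *
      act (\<Prod>a\<in>S. mon (scale q a0) 1 - mon (scale q a) 1) f (x + a0))"
    by (simp add: far_annihilators_def act_single_mult[abs_def])
  \<comment> \<open>The factor \<open>mon a0 (c a0)\<close> is harmless: its exponent is undone by a
    shift and its nonzero coefficient cancels.\<close>
  from far_zero_shift[OF this, of "- a0"] c0
  have "far_zero d (act (\<Prod>a\<in>S. mon (scale q a0) 1 - mon (scale q a) 1) f)"
    by (simp add: far_zero_def)
  moreover have "q > 0" by (simp add: q_def)
  ultimately show ?thesis by blast
qed

section \<open>Definability from an annihilator and definable sections\<close>

text \<open>Slices stay predicates in all \<open>d\<close> variables, so shifts apply to them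
  directly. Integer values are allowed because differences of indicator functions arise.\<close>

definition sections_definable :: "nat \<Rightarrow> ((nat \<Rightarrow> int) \<Rightarrow> int) \<Rightarrow> bool" where
  "sections_definable d f \<longleftrightarrow> (\<forall>i<d. \<forall>c a. definable d (\<lambda>x. x i = c \<and> f x = a))"

definition line :: "(nat \<Rightarrow> int) \<Rightarrow> (nat \<Rightarrow> int) \<Rightarrow> int \<Rightarrow> nat \<Rightarrow> int" where
  "line x v l = (\<lambda>i. x i + l * v i)"

lemma line_0: "line x v 0 = x"
  by (simp add: line_def)

lemma line_line: "line (line x v l) v m = line x v (l + m)"
  by (simp add: line_def algebra_simps)

lemma line_add: "line x v l + v = line x v (l + 1)"
  by (simp add: line_def fun_eq_iff algebra_simps)

lemma definable_line:
  assumes "definable d P" "\<And>i. i < d \<Longrightarrow> r i < m" "j < m"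
  shows "definable m (\<lambda>u. P (line (\<lambda>i. u (r i)) w (u j)))"
proof -
  have "definable m (\<lambda>u. P (\<lambda>i. u (r i) + w i * u j))"
    using assms by (intro definable_subst[OF assms(1)] definable_fun_intros) auto
  then show ?thesis by (simp add: line_def mult.commute)
qed

lemma definable_shift:
  assumes "definable d P"
  shows "definable d (\<lambda>x. P (x + v))"
proof -
  have "definable d (\<lambda>x. P (\<lambda>i. x i + v i))"
    by (intro definable_subst[OF assms] definable_fun_intros)
  then show ?thesis by (simp add: plus_fun_def)
qed

text \<open>Finitely many predicates \<open>f x = a\<close> are combined into the set of those
  values \<open>a\<close> that are attained at \<open>x\<close>, a singleton from which
  \<open>f x\<close> is read off.\<close>

lemma quasi_affine_finite_range:
  assumes "finite (range f)" "\<And>a. definable d (\<lambda>x. f x = a)"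
  shows "quasi_affine d f"
proof -
  have "quasi_affine d (\<lambda>x. {a \<in> S. f x = a})" if "finite S" for S
    using that
  proof (induction S rule: finite_induct)
    case empty
    then show ?case using quasi_affine_const by simp
  next
    case (insert b S)
    have eq: "{a \<in> insert b S. f x = a} =
        (if f x = b then insert b {a \<in> S. f x = a} else {a \<in> S. f x = a})" for x
      by auto
    show ?case unfolding eq
      by (rule quasi_affine_combine[where op="\<lambda>c R. if c then insert b R else R"])
        (use insert.IH assms(2) quasi_affine_definable in auto)
  qed
  from quasi_affine_map[OF this[OF assms(1)], of the_elem]
  have "quasi_affine d (\<lambda>x. the_elem {a \<in> range f. f x = a})" .
  moreover have "{a \<in> range f. f x = a} = {f x}" for x by auto
  ultimately show ?thesis by simp
qed

section \<open>Jumps of a function along a line\<close>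

lemma int_le_div_iff: "0 < b \<Longrightarrow> l \<le> a div b \<longleftrightarrow> l * b \<le> a" for a b l :: int
  using pos_imp_zdiv_nonneg_iff[of b "a - l * b"] div_mult_self1[of b a "- l"] by simp

text \<open>An affine function of \<open>l\<close> crosses the threshold at most once, so the
  answers at \<open>l\<close> and \<open>l + N\<close> can differ only for the \<open>N\<close>
  values of \<open>l\<close> just before the crossing.\<close>

lemma threshold_changes:
  fixes A B b N :: int
  assumes "N > 0"
  shows "\<exists>q. {l. (A + l * B \<le> b) \<noteq> (A + (l + N) * B \<le> b)} \<subseteq> {q - N + 1..q}"
proof -
  consider "B = 0" | "B > 0" | "B < 0" by linarith
  then show ?thesis
  proof cases
    case 1
    then show ?thesis by auto
  next
    case 2
    define q where "q = (b - A) div B"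
    have le: "A + l * B \<le> b \<longleftrightarrow> l \<le> q" for l
    proof -
      have "l \<le> q \<longleftrightarrow> l * B \<le> b - A"
        unfolding q_def using 2 by (intro int_le_div_iff)
      then show ?thesis by auto
    qed
    show ?thesis unfolding le using assms by (intro exI[of _ q]) auto
  next
    case 3
    define q where "q = (A - b - 1) div (- B)"
    \<comment> \<open>For negative slope \<open>q\<close> is the last place where the value still
      exceeds \<open>b\<close>, that is, where it is at least \<open>b + 1\<close>.\<close>
    have le: "A + l * B \<le> b \<longleftrightarrow> \<not> l \<le> q" for l
    proof -
      have "l \<le> q \<longleftrightarrow> l * (- B) \<le> A - b - 1"
        unfolding q_def using 3 by (intro int_le_div_iff) simp
      then show ?thesis by auto
    qed
    show ?thesis unfolding le using assms by (intro exI[of _ q]) auto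
  qed
qed

lemma card_UN_intervals_le:
  fixes lo hi :: "'a \<Rightarrow> int"
  assumes "finite S" "\<And>s. s \<in> S \<Longrightarrow> T s \<subseteq> {lo s..hi s}" "\<And>s. s \<in> S \<Longrightarrow> hi s - lo s < W"
  shows "finite (\<Union>s\<in>S. T s) \<and> card (\<Union>s\<in>S. T s) \<le> card S * nat W"
proof
  show "finite (\<Union>s\<in>S. T s)"
    using assms(1,2) by (meson finite_UN_I finite_atLeastAtMost_int finite_subset)
  have "card (T s) \<le> nat W" if "s \<in> S" for s
  proof -
    have "card (T s) \<le> card {lo s..hi s}" using assms(2)[OF that] by (intro card_mono) auto
    then show ?thesis using assms(3)[OF that] by simp
  qed
  then show "card (\<Union>s\<in>S. T s) \<le> card S * nat W"
    using card_UN_le[OF assms(1), of T] sum_bounded_above[of S "\<lambda>s. card (T s)" "nat W"]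
    by fastforce
qed

text \<open>On a line, a quasi-affine increment is periodic apart from boundedly many changes, and a nonzero
  sum over one period cannot persist because \<open>f\<close> is bounded.\<close>

lemma bounded_jumps:
  fixes f :: "(nat \<Rightarrow> int) \<Rightarrow> int"
  assumes fin: "finite (range f)" and qa: "quasi_affine d (\<lambda>x. f (x + v) - f x)"
  shows "\<exists>N>0. \<exists>K. \<forall>x. finite {l. f (line x v (l + int N)) \<noteq> f (line x v l)} \<and>
    card {l. f (line x v (l + int N)) \<noteq> f (line x v l)} \<le> K"
proof -
  obtain H N where H: "finite H" "N > 0"
    "\<And>x y. same_cell d H N x y \<Longrightarrow> f (x + v) - f x = f (y + v) - f y"
    using qa unfolding quasi_affine_def by blast
  obtain R where R: "\<And>x y. f x - f y \<le> R"
  proof -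
    have "finite ((\<lambda>(a, b). a - b) ` (range f \<times> range f))" using fin by simp
    then have "f x - f y \<le> Max ((\<lambda>(a, b). a - b) ` (range f \<times> range f))" for x y
      by (intro Max_ge) auto
    then show ?thesis using that by blast
  qed
  have R0: "R \<ge> 0" using R[of 0 0] by simp
  \<comment> \<open>\<open>R\<close> bounds the oscillation of \<open>f\<close>. A constant nonzero
    change per period, kept for \<open>R + 1\<close> periods, would move \<open>f\<close> by at
    least \<open>R + 1\<close>; these periods have total length \<open>W\<close>.\<close>
  define W where "W = N * (R + 1)"
  define K where "K = card H * nat N * nat W"
  have "finite {l. f (line x v (l + N)) \<noteq> f (line x v l)} \<and>
    card {l. f (line x v (l + N)) \<noteq> f (line x v l)} \<le> K" for x
  proof -
    define g where "g l = f (line x v l)" for l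
    define D where "D l = g (l + N) - g l" for l
    \<comment> \<open>\<open>D\<close> is the change over one period and \<open>Bad\<close> marks
      where \<open>D\<close> itself changes. This requires some half space in \<open>H\<close> to
      separate the points \<open>l\<close> and \<open>l + N\<close>, since their residues modulo
      \<open>N\<close> agree.\<close>
    define Bad where "Bad = {l. D (l + 1) \<noteq> D l}"
    define C where "C h = {l. (lin d (fst h) x + l * lin d (fst h) v \<le> snd h) \<noteq>
        (lin d (fst h) x + (l + N) * lin d (fst h) v \<le> snd h)}" for h
    have lin_line: "lin d a (line x v l) = lin d a x + l * lin d a v" for a l
      by (simp add: lin_def line_def algebra_simps sum.distrib sum_distrib_left)
    have step: "g (l + 1) - g l = f (line x v l + v) - f (line x v l)" for l
      by (simp add: g_def line_add)
    have Bad: "Bad \<subseteq> (\<Union>h\<in>H. C h)"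
    proof (rule ccontr)
      assume "\<not> ?thesis"
      then obtain l where l: "l \<in> Bad" "\<And>h. h \<in> H \<Longrightarrow> l \<notin> C h" by blast
      have "same_cell d H N (line x v l) (line x v (l + N))"
        unfolding same_cell_def
      proof (intro conjI ballI allI impI)
        fix h assume "h \<in> H"
        from l(2)[OF this] show "case h of (a, b) \<Rightarrow>
            lin d a (line x v l) \<le> b \<longleftrightarrow> lin d a (line x v (l + N)) \<le> b"
          by (auto simp: C_def lin_line)
      next
        fix i
        show "[line x v l i = line x v (l + N) i] (mod N)"
          by (simp add: line_def cong_iff_dvd_diff algebra_simps)
      qed
      from H(3)[OF this] have "g (l + 1) - g l = g (l + N + 1) - g (l + N)"
        by (simp add: step)
      then have "D (l + 1) = D l" by (simp add: D_def add.commute add.left_commute)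
      then show False using l(1) by (simp add: Bad_def)
    qed
    have "\<exists>q. C h \<subseteq> {q - N + 1..q}" for h
      unfolding C_def using H(2) by (rule threshold_changes)
    then obtain q where q: "\<And>h. C h \<subseteq> {q h - N + 1..q h}" by metis
    have C: "finite (\<Union>h\<in>H. C h) \<and> card (\<Union>h\<in>H. C h) \<le> card H * nat N"
      by (rule card_UN_intervals_le[OF H(1) q]) simp
    then have finBad: "finite Bad" "card Bad \<le> card H * nat N"
      using Bad by (auto intro: finite_subset dest: card_mono)
    \<comment> \<open>Each jump has a bad position among \<open>l, ..., l + W - 1\<close>; hence at
      most \<open>W\<close> jumps are charged to one bad position.\<close>
    have near: "\<exists>l'\<in>Bad. l \<in> {l' - W + 1..l'}" if "D l \<noteq> 0" for l
    proof (rule ccontr)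
      assume no: "\<not> ?thesis"
      have const: "int t \<le> W \<Longrightarrow> D (l + int t) = D l" for t
      proof (induction t)
        case (Suc t)
        have "l + int t \<notin> Bad" using no Suc.prems by auto
        then show ?case using Suc by (simp add: Bad_def algebra_simps)
      qed simp
      have run: "int k \<le> R + 1 \<Longrightarrow> g (l + int k * N) = g l + int k * D l" for k
      proof (induction k)
        case (Suc k)
        have le: "int k * N \<le> W"
          using Suc.prems H(2) by (simp add: W_def mult.commute mult_right_mono)
        then have "D (l + int k * N) = D l"
          using const[of "nat (int k * N)"] H(2) by simp
        then show ?case using Suc by (simp add: D_def algebra_simps)
      qed simp
      have eq: "g (l + (R + 1) * N) - g l = (R + 1) * D l"
        using run[of "nat (R + 1)"] R0 by simp
      have "\<bar>g (l + (R + 1) * N) - g l\<bar> \<le> R"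
        using R by (auto simp: g_def abs_le_iff)
      moreover have "R + 1 \<le> \<bar>(R + 1) * D l\<bar>"
        using that R0 mult_left_mono[of 1 "\<bar>D l\<bar>" "R + 1"] by (simp add: abs_mult)
      ultimately show False using eq by linarith
    qed
    have sub: "{l. D l \<noteq> 0} \<subseteq> (\<Union>l'\<in>Bad. {l' - W + 1..l'})" using near by blast
    have "finite (\<Union>l'\<in>Bad. {l' - W + 1..l'}) \<and>
        card (\<Union>l'\<in>Bad. {l' - W + 1..l'}) \<le> card Bad * nat W"
      by (rule card_UN_intervals_le[OF finBad(1) subset_refl]) simp
    moreover have "card Bad * nat W \<le> K" using finBad(2) by (simp add: K_def)
    ultimately have "finite {l. D l \<noteq> 0} \<and> card {l. D l \<noteq> 0} \<le> K"
      using sub by (meson card_mono finite_subset le_trans)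
    then show ?thesis by (simp add: D_def g_def)
  qed
  then show ?thesis using H(2)
    by (intro exI[of _ "nat N"] conjI exI[of _ K]) auto
qed

section \<open>Definability by walking along a fixed direction\<close>

lemma definable_reach:
  assumes "definable d Z" "definable d T"
  shows "definable d (\<lambda>x. \<exists>l\<ge>0. (\<forall>l'. 0 \<le> l' \<and> l' < l \<longrightarrow> Z (line x w l')) \<and> T (line x w l))"
proof -
  have "definable (Suc (Suc d)) (\<lambda>u. 0 \<le> u 0 \<and> u 0 < u 1 \<longrightarrow> Z (line (\<lambda>i. u (Suc (Suc i))) w (u 0)))"
    using definable_line[OF assms(1), of "\<lambda>i. Suc (Suc i)" "Suc (Suc d)" 0 w]
    by (intro definable_imp definable_conj definable_le[of _ "\<lambda>_. 0"] definable_less definable_fun_intros)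
      auto
  from definable_all[OF this]
  have "definable (Suc d) (\<lambda>u. \<forall>l'. 0 \<le> l' \<and> l' < u 0 \<longrightarrow> Z (line (\<lambda>i. u (Suc i)) w l'))"
    by simp
  then have "definable (Suc d) (\<lambda>u. 0 \<le> u 0 \<and>
      (\<forall>l'. 0 \<le> l' \<and> l' < u 0 \<longrightarrow> Z (line (\<lambda>i. u (Suc i)) w l')) \<and>
      T (line (\<lambda>i. u (Suc i)) w (u 0)))"
    using definable_line[OF assms(2), of "\<lambda>i. Suc i" "Suc d" 0 w]
    by (intro definable_conj definable_le[of _ "\<lambda>_. 0"] definable_fun_intros) auto
  from definable_ex[OF this] show ?thesis by simp
qed

text \<open>Starting from a point of the half space \<open>0 \<le> s * x i\<close> one follows the direction \<open>w\<close> down to the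
  strip \<open>0 \<le> s * x i < m\<close>, where \<open>f\<close> is known; the recursion is on the number of jumps of
  \<open>f\<close> met on the way.\<close>

lemma definable_half_space:
  fixes f :: "(nat \<Rightarrow> int) \<Rightarrow> int" and s :: int
  assumes fin: "finite (range f)" and sec: "sections_definable d f"
    and i: "i < d" and s: "\<bar>s\<bar> = 1" and m: "m = - (s * w i)" "m > 0"
    and inc: "\<And>b. definable d (\<lambda>x. f (x + w) - f x = b)"
    and jumps: "\<And>x. finite {l. f (line x w (l + 1)) \<noteq> f (line x w l)}"
      "\<And>x. card {l. f (line x w (l + 1)) \<noteq> f (line x w l)} \<le> K"
  shows "definable d (\<lambda>x. 0 \<le> s * x i \<and> f x = a)"
proof -
  define Z where "Z x \<longleftrightarrow> f (x + w) - f x = 0" for x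
  have Z: "definable d Z" using inc[of 0] by (simp add: Z_def[abs_def])
  \<comment> \<open>The number of steps that bring \<open>s * x i\<close> into the strip, its
    remainder modulo \<open>m\<close>. \<open>J x\<close> collects the jumps met before.\<close>
  define steps where "steps x = (s * x i) div m" for x :: "nat \<Rightarrow> int"
  define J where "J x = {l. 0 \<le> l \<and> l < steps x \<and> \<not> Z (line x w l)}" for x
  have finJ: "finite (J x)" for x
    by (rule finite_subset[of _ "{0..<steps x}"]) (auto simp: J_def)
  have coord: "s * line x w l i = s * x i - l * m" for x l
    by (simp add: line_def m algebra_simps)
  have const: "f (line x w l) = f x" if "l \<ge> 0" "\<forall>l'. 0 \<le> l' \<and> l' < l \<longrightarrow> Z (line x w l')" for x l
  proof -
    have "int t \<le> l \<Longrightarrow> f (line x w (int t)) = f x" for t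
    proof (induction t)
      case (Suc t)
      then have "Z (line x w (int t))" "f (line x w (int t)) = f x" using that(2) by simp_all
      then show ?case unfolding Z_def line_add by (simp add: add.commute)
    qed (simp add: line_0)
    from this[of "nat l"] that(1) show ?thesis by simp
  qed
  \<comment> \<open>The number of jumps of \<open>x\<close> is not itself expressed by a formula. So
    \<open>G\<close> is sound at every point but required to be complete only at points with at most
    \<open>k\<close> jumps.\<close>
  have "\<exists>G. definable d G \<and> (\<forall>x. G x \<longrightarrow> f x = a) \<and>
      (\<forall>x. 0 \<le> s * x i \<and> card (J x) \<le> k \<and> f x = a \<longrightarrow> G x)" for k a
  proof (induction k arbitrary: a)
    case 0
    \<comment> \<open>As \<open>s\<close> is 1 or -1, \<open>y i = s * c\<close> says
      \<open>s * y i = c\<close>; the strip is a finite union of sections.\<close>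
    define T where "T y \<longleftrightarrow> (\<exists>c\<in>{0..<m}. y i = s * c \<and> f y = a)" for y
    have T: "definable d T"
      unfolding T_def[abs_def] using sec i
      by (intro definable_finite_ex) (auto simp: sections_definable_def)
    define G where "G x \<longleftrightarrow>
      (\<exists>l\<ge>0. (\<forall>l'. 0 \<le> l' \<and> l' < l \<longrightarrow> Z (line x w l')) \<and> T (line x w l))" for x
    have "f x = a" if "G x" for x
      using that const by (auto simp: G_def T_def)
    moreover have "G x" if "0 \<le> s * x i" "card (J x) = 0" "f x = a" for x
    proof -
      have "J x = {}" using that(2) finJ by simp
      then have free: "\<forall>l'. 0 \<le> l' \<and> l' < steps x \<longrightarrow> Z (line x w l')" by (auto simp: J_def)
      have st: "steps x \<ge> 0" using that(1) m(2) by (simp add: steps_def pos_imp_zdiv_nonneg_iff)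
      have "s * line x w (steps x) i = (s * x i) mod m"
        by (simp add: coord steps_def minus_div_mult_eq_mod)
      then have "s * line x w (steps x) i \<in> {0..<m}" using m(2) by simp
      moreover have "line x w (steps x) i = s * (s * line x w (steps x) i)"
        using s by (auto simp: abs_if split: if_splits)
      ultimately have "T (line x w (steps x))"
        using const[OF st free] that(3) unfolding T_def by blast
      then show ?thesis unfolding G_def using st free by blast
    qed
    moreover have "definable d G"
      unfolding G_def[abs_def] by (rule definable_reach[OF Z T])
    ultimately show ?case by (intro exI[of _ G]) auto
  next
    case (Suc k)
    then obtain G where G: "\<And>a. definable d (G a)" "\<And>a x. G a x \<Longrightarrow> f x = a"
      "\<And>a x. 0 \<le> s * x i \<Longrightarrow> card (J x) \<le> k \<Longrightarrow> f x = a \<Longrightarrow> G a x"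
      by metis
    \<comment> \<open>At the jump, the value \<open>b\<close> after it and the increment
      \<open>b - a\<close> together force the value \<open>a\<close> before it.\<close>
    define T where "T y \<longleftrightarrow> (\<exists>b\<in>range f. f (y + w) - f y = b - a \<and> G b (y + w))" for y
    have T: "definable d T"
      unfolding T_def[abs_def] using fin
      by (intro definable_finite_ex definable_conj inc definable_shift[OF G(1)])
    define G' where "G' x \<longleftrightarrow> G a x \<or>
      (\<exists>l\<ge>0. (\<forall>l'. 0 \<le> l' \<and> l' < l \<longrightarrow> Z (line x w l')) \<and> T (line x w l))" for x
    have "f x = a" if "G' x" for x
      using that unfolding G'_def
    proof (elim disjE exE conjE)
      fix l assume l: "0 \<le> l" "\<forall>l'. 0 \<le> l' \<and> l' < l \<longrightarrow> Z (line x w l')" "T (line x w l)"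
      then have "f (line x w l) = a" using G(2) by (fastforce simp: T_def)
      then show ?thesis using const[OF l(1,2)] by simp
    qed (rule G(2))
    moreover have "G' x" if x: "0 \<le> s * x i" "card (J x) \<le> Suc k" "f x = a" for x
    proof (cases "card (J x) \<le> k")
      case True
      then show ?thesis using G(3) x by (simp add: G'_def)
    next
      case False
      then have ne: "J x \<noteq> {}" by auto
      define l where "l = Min (J x)"
      have lJ: "l \<in> J x" using Min_in[OF finJ ne] by (simp add: l_def)
      have free: "\<forall>l'. 0 \<le> l' \<and> l' < l \<longrightarrow> Z (line x w l')"
      proof (intro allI impI)
        fix l' assume l': "0 \<le> l' \<and> l' < l"
        then have "l' \<notin> J x" using Min_le[OF finJ] by (force simp: l_def)
        then show "Z (line x w l')" using l' lJ by (auto simp: J_def)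
      qed
      define y where "y = line x w (l + 1)"
      have steps_y: "steps y = steps x - (l + 1)"
      proof -
        have "s * y i = s * x i + (- (l + 1)) * m" by (simp add: y_def coord algebra_simps)
        then show ?thesis unfolding steps_def using m(2) by (simp only: div_mult_self1)
      qed
      have "(l + 1) * m \<le> s * x i"
      proof -
        have "l + 1 \<le> steps x" using lJ by (simp add: J_def)
        then show ?thesis using m(2) by (simp add: steps_def int_le_div_iff)
      qed
      then have y0: "0 \<le> s * y i" by (simp add: y_def coord)
      have "line y w j = line x w (j + (l + 1))" for j
        by (simp add: y_def line_line add.commute)
      \<comment> \<open>Here \<open>y\<close> is the point right after the first jump
        \<open>l\<close>. Translated by \<open>l + 1\<close>, its jumps are jumps of
        \<open>x\<close> other than \<open>l\<close>, so one jump has been used up.\<close>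
      then have "(\<lambda>j. j + (l + 1)) ` J y \<subseteq> J x - {l}"
        using lJ by (auto simp: J_def steps_y)
      then have "card (J y) \<le> card (J x - {l})"
        using finJ by (intro card_inj_on_le[of "\<lambda>j. j + (l + 1)"]) (auto simp: inj_on_def)
      also have "\<dots> \<le> k" using x(2) lJ finJ by simp
      finally have "G (f y) y" using G(3) y0 by blast
      moreover have "f (line x w l) = a" using const[OF _ free] lJ x(3) by (simp add: J_def)
      ultimately have "T (line x w l)"
        unfolding T_def line_add y_def by (intro bexI[of _ "f (line x w (l + 1))"]) auto
      then show ?thesis using free lJ by (auto simp: G'_def J_def)
    qed
    moreover have "definable d G'"
      unfolding G'_def[abs_def] by (intro definable_disj G(1) definable_reach Z T)
    ultimately show ?case by (intro exI[of _ G']) auto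
  qed
  then obtain G where G: "definable d G" "\<And>x. G x \<Longrightarrow> f x = a"
    "\<And>x. 0 \<le> s * x i \<Longrightarrow> card (J x) \<le> K \<Longrightarrow> f x = a \<Longrightarrow> G x"
    by metis
  have "card (J x) \<le> K" for x
  proof -
    have "J x \<subseteq> {l. f (line x w (l + 1)) \<noteq> f (line x w l)}"
      by (auto simp: J_def Z_def line_add)
    then show ?thesis using jumps[of x] by (meson card_mono le_trans)
  qed
  then have "0 \<le> s * x i \<and> f x = a \<longleftrightarrow> 0 \<le> s * x i \<and> G x" for x
    using G by blast
  moreover have "definable d (\<lambda>x. 0 \<le> s * x i \<and> G x)"
    using i by (intro definable_conj G(1) definable_le[of _ "\<lambda>_. 0"] definable_fun_intros)
  ultimately show ?thesis by simp
qed

lemma definable_sum_eq: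
  fixes f g :: "(nat \<Rightarrow> int) \<Rightarrow> int"
  assumes "finite (range f)" "\<And>a. definable d (\<lambda>x. f x = a)" "\<And>a. definable d (\<lambda>x. g x = a)"
  shows "definable d (\<lambda>x. f x + g x = c)"
proof -
  have "f x + g x = c \<longleftrightarrow> (\<exists>b\<in>range f. f x = b \<and> g x = c - b)" for x by auto
  moreover have "definable d (\<lambda>x. \<exists>b\<in>range f. f x = b \<and> g x = c - b)"
    using assms by (intro definable_finite_ex definable_conj)
  ultimately show ?thesis by simp
qed

lemma finite_range_diff:
  fixes f :: "'a \<Rightarrow> int"
  assumes "finite (range f)"
  shows "finite (range (\<lambda>x. f (p x) - f (q x)))"
proof -
  have "range (\<lambda>x. f (p x) - f (q x)) \<subseteq> (\<lambda>(a, b). a - b) ` (range f \<times> range f)" by auto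
  then show ?thesis by (rule finite_subset) (simp add: assms)
qed

text \<open>Only the multiple \<open>w = N v\<close> provided by \<open>bounded_jumps\<close> has
  boundedly many jumps. Its increments are telescoping sums of increments along \<open>v\<close>,
  and its jumps at \<open>l\<close> are jumps over a period at \<open>l * N\<close>.\<close>

lemma definable_one_side:
  fixes f :: "(nat \<Rightarrow> int) \<Rightarrow> int" and s :: int
  assumes fin: "finite (range f)" and sec: "sections_definable d f"
    and i: "i < d" and s: "\<bar>s\<bar> = 1" "s * v i < 0"
    and inc: "\<And>b. definable d (\<lambda>x. f (x + v) - f x = b)"
  shows "definable d (\<lambda>x. 0 \<le> s * x i \<and> f x = a)"
proof -
  have "quasi_affine d (\<lambda>x. f (x + v) - f x)"
    by (rule quasi_affine_finite_range[OF finite_range_diff[OF fin, of "\<lambda>x. x + v" "\<lambda>x. x"] inc])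
  from bounded_jumps[OF fin this] obtain N K where N: "N > 0"
    and K: "\<And>x. finite {l. f (line x v (l + int N)) \<noteq> f (line x v l)}"
      "\<And>x. card {l. f (line x v (l + int N)) \<noteq> f (line x v l)} \<le> K"
    by blast
  define w where "w = scale N v"
  have line_w: "line x w l = line x v (l * int N)" for x l
    by (simp add: line_def w_def scale_def mult.assoc)
  have "definable d (\<lambda>x. f (x + scale n v) - f x = b)" for n b
  proof (induction n arbitrary: b)
    case 0
    have "scale 0 v = 0" by (simp add: scale_def fun_eq_iff)
    then show ?case using definable_const[of d "0 = b"] by simp
  next
    case (Suc n)
    have "definable d (\<lambda>x. f ((x + scale n v) + v) - f (x + scale n v) = b)" for b
      by (rule definable_shift[OF inc])
    moreover have "finite (range (\<lambda>x. f (x + scale n v) - f x))" by (rule finite_range_diff[OF fin])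
    ultimately have "definable d (\<lambda>x. (f (x + scale n v) - f x) + (f ((x + scale n v) + v) - f (x + scale n v)) = b)"
      using Suc by (intro definable_sum_eq)
    then
    have "definable d (\<lambda>x. f ((x + scale n v) + v) - f x = b)" by simp
    moreover have "x + scale n v + v = x + scale (Suc n) v" for x
      by (simp add: scale_def fun_eq_iff algebra_simps)
    ultimately show ?case by (simp add: plus_fun_def)
  qed
  then have inc': "definable d (\<lambda>x. f (x + w) - f x = b)" for b by (simp add: w_def)
  have sub: "(\<lambda>l. l * int N) ` {l. f (line x w (l + 1)) \<noteq> f (line x w l)} \<subseteq>
      {l. f (line x v (l + int N)) \<noteq> f (line x v l)}" for x
    by (auto simp: line_w algebra_simps)
  have inj: "inj_on (\<lambda>l. l * int N) S" for S using N by (auto simp: inj_on_def)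
  have jumps: "finite {l. f (line x w (l + 1)) \<noteq> f (line x w l)}"
    "card {l. f (line x w (l + 1)) \<noteq> f (line x w l)} \<le> K" for x
    using inj_on_finite[OF inj sub K(1)] card_inj_on_le[OF inj sub K(1)] K(2) le_trans by blast+
  have "s * w i = int N * (s * v i)" by (simp add: w_def scale_def)
  moreover have "int N * (s * v i) < 0" using N by (intro mult_pos_neg[OF _ s(2)]) simp
  ultimately have "- (s * w i) > 0" by linarith
  from definable_half_space[OF fin sec i s(1) refl this inc' jumps] show ?thesis .
qed

lemma definable_of_increment:
  fixes f :: "(nat \<Rightarrow> int) \<Rightarrow> int"
  assumes fin: "finite (range f)" and sec: "sections_definable d f"
    and i: "i < d" "v i \<noteq> 0"
    and inc: "\<And>b. definable d (\<lambda>x. f (x + v) - f x = b)"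
  shows "definable d (\<lambda>x. f x = a)"
proof -
  \<comment> \<open>With this sign \<open>v\<close> lowers \<open>s * x i\<close>. The opposite half
    space is treated with \<open>- v\<close>, and together the two cover everything.\<close>
  define s where "s = - sgn (v i)"
  have s: "\<bar>s\<bar> = 1" "s * v i < 0" "\<bar>- s\<bar> = 1" "- s * (- v) i < 0"
    using i(2) by (auto simp: s_def sgn_if)
  have "definable d (\<lambda>x. f ((x - v) + v) - f (x - v) = - b)" for b
    using definable_shift[OF inc[of "- b"], of "- v"] by simp
  moreover have "f ((x - v) + v) - f (x - v) = - b \<longleftrightarrow> f (x + - v) - f x = b" for x b by auto
  ultimately have "definable d (\<lambda>x. f (x + - v) - f x = b)" for b by simp
  from definable_disj[OF definable_one_side[OF fin sec i(1) s(1,2) inc]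
      definable_one_side[OF fin sec i(1) s(3,4) this], of a a]
  have "definable d (\<lambda>x. 0 \<le> s * x i \<and> f x = a \<or> 0 \<le> - s * x i \<and> f x = a)" .
  moreover have "0 \<le> s * x i \<and> f x = a \<or> 0 \<le> - s * x i \<and> f x = a \<longleftrightarrow> f x = a" for x
    by auto
  ultimately show ?thesis by simp
qed

text \<open>Applying one factor to \<open>f\<close> gives a function \<open>h\<close> that satisfies
  the same assumptions with one factor fewer. Up to a shift, \<open>h\<close> is the increment of
  \<open>f\<close> in the nonzero direction \<open>u - t b\<close>, so \<open>f\<close> is recovered
  by \<open>definable_of_increment\<close>.\<close>

lemma definable_of_annihilator:
  fixes f :: "(nat \<Rightarrow> int) \<Rightarrow> int"
  assumes "finite S" "d \<ge> 1" "finite (range f)" "sections_definable d f"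
    "far_zero d (act (\<Prod>a\<in>S. mon u 1 - mon (t a) 1) f)"
    "\<And>a. a \<in> S \<Longrightarrow> \<exists>i<d. u i \<noteq> t a i"
  shows "definable d (\<lambda>x. f x = c)"
  using assms(1,3-)
proof (induction S arbitrary: f c rule: finite_induct)
  case empty
  then obtain L where L: "\<And>x i. i < d \<Longrightarrow> L \<le> \<bar>x i\<bar> \<Longrightarrow> f x = 0"
    unfolding far_zero_def by (auto simp: act_one)
  \<comment> \<open>With no factor left \<open>f\<close> itself vanishes far out, so finitely many
    sections in coordinate 0 describe it.\<close>
  have "f x = c \<longleftrightarrow> (\<exists>k\<in>{-L<..<L}. x 0 = k \<and> f x = c) \<or> (L \<le> x 0 \<or> x 0 \<le> - L) \<and> 0 = c" for x
    using L[of 0 x] assms(2) by (cases "L \<le> \<bar>x 0\<bar>") auto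
  moreover have "definable d (\<lambda>x. \<exists>k\<in>{-L<..<L}. x 0 = k \<and> f x = c)"
    using empty.prems(2) assms(2) by (intro definable_finite_ex) (auto simp: sections_definable_def)
  then have "definable d (\<lambda>x. (\<exists>k\<in>{-L<..<L}. x 0 = k \<and> f x = c) \<or> (L \<le> x 0 \<or> x 0 \<le> - L) \<and> 0 = c)"
    using assms(2)
    by (intro definable_disj[of d "\<lambda>x. \<exists>k\<in>{-L<..<L}. x 0 = k \<and> f x = c"] definable_disj
        definable_conj definable_const
        definable_le[of _ "\<lambda>_. L"] definable_le[of _ _ "\<lambda>_. - L"] definable_fun_intros) auto
  ultimately show ?case by simp
next
  case (insert b S)
  define h where "h = act (mon u 1 - mon (t b) 1) f"
  have h: "h x = f (x + u) - f (x + t b)" for x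
    by (simp add: h_def act_diff act_single)
  have "finite (range h)"
    using finite_range_diff[OF insert.prems(1)] by (simp add: h[abs_def])
  moreover have "sections_definable d h"
    unfolding sections_definable_def
  proof (intro allI impI)
    fix i k a assume i: "i < d"
    have sh: "definable d (\<lambda>x. x i = k \<and> f (x + v) = e)" for v e
      using definable_shift[of d "\<lambda>x. x i = k + v i \<and> f x = e" v] insert.prems(2) i
      by (simp add: sections_definable_def)
    have "x i = k \<and> h x = a \<longleftrightarrow>
        (\<exists>e\<in>range f. (x i = k \<and> f (x + u) = a + e) \<and> (x i = k \<and> f (x + t b) = e))" for x
      by (auto simp: h)
    moreover have "definable d (\<lambda>x. \<exists>e\<in>range f. (x i = k \<and> f (x + u) = a + e) \<and> (x i = k \<and> f (x + t b) = e))"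
      using insert.prems(1) by (intro definable_finite_ex definable_conj[OF sh sh])
    ultimately show "definable d (\<lambda>x. x i = k \<and> h x = a)" by simp
  qed
  moreover have "far_zero d (act (\<Prod>a\<in>S. mon u 1 - mon (t a) 1) h)"
  proof -
    have "act (\<Prod>a\<in>S. mon u 1 - mon (t a) 1) h = act (\<Prod>a\<in>insert b S. mon u 1 - mon (t a) 1) f"
      using insert.hyps by (simp add: h_def fun_eq_iff act_mult act_commute)
    then show ?thesis using insert.prems(3) by simp
  qed
  ultimately have hdef: "definable d (\<lambda>x. h x = a)" for a
    using insert.prems(4) by (intro insert.IH) auto
  have inc: "definable d (\<lambda>x. f (x + (u - t b)) - f x = a)" for a
    using definable_shift[OF hdef[of a], of "- t b"] by (simp add: h algebra_simps)
  obtain i where i: "i < d" "u i \<noteq> t b i" using insert.prems(4) by blast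
  then have "(u - t b) i \<noteq> 0" by simp
  from definable_of_increment[OF insert.prems(1,2) i(1) this inc] show ?case .
qed

section \<open>Counting recurrent blocks\<close>

interpretation real_funs: vector_space "\<lambda>(r::real) (g::nat \<Rightarrow> real). (\<lambda>i. r * g i)"
  by unfold_locales (auto simp: fun_eq_iff algebra_simps)

text \<open>If the rank of \<open>I\<close> is below \<open>d\<close>, a basis \<open>J\<close>
  determines all forms in \<open>I\<close>. If it is \<open>d\<close>, every coordinate is a real
  combination of the forms, so bounds on them bound the point.\<close>

lemma rank_dichotomy:
  fixes I :: "(nat \<Rightarrow> int) set"
  assumes "finite I"
  shows "(\<exists>J\<subseteq>I. card J < d \<and>
      (\<forall>x y. (\<forall>a\<in>J. lin d a x = lin d a y) \<longrightarrow> (\<forall>a\<in>I. lin d a x = lin d a y))) \<or>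
    (\<exists>D::real. \<forall>x t. (\<forall>a\<in>I. \<bar>lin d a x\<bar> \<le> t) \<longrightarrow> (\<forall>i<d. real_of_int \<bar>x i\<bar> \<le> D * real_of_int t))"
proof -
  define V where "V a = (\<lambda>i. if i < d then real_of_int (a i) else 0)" for a :: "nat \<Rightarrow> int"
  define e where "e k = (\<lambda>i::nat. if i = k then 1 else 0 :: real)" for k
  define dot where "dot g x = (\<Sum>i<d. g i * real_of_int (x i))" for g and x :: "nat \<Rightarrow> int"
  have dot_V: "dot (V a) x = real_of_int (lin d a x)" for a x
    by (simp add: dot_def V_def lin_def)
  have dot_e: "dot (e k) x = real_of_int (x k)" if "k < d" for k x
    using that by (simp add: dot_def e_def if_distrib[of "\<lambda>u. u * _"] cong: if_cong)
  have dot_add: "dot (g + h) x = dot g x + dot h x" for g h x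
    by (simp add: dot_def distrib_right sum.distrib)
  have dot_scale: "dot (\<lambda>i. r * g i) x = r * dot g x" for r g x
    by (simp add: dot_def sum_distrib_left mult.assoc)
  have dot_0: "dot 0 x = 0" for x
    by (simp add: dot_def)
  have V_span: "V a \<in> real_funs.span (e ` {..<d})" for a
  proof -
    have "V a = (\<Sum>k<d. (\<lambda>i. real_of_int (a k) * e k i))"
    proof
      fix i
      have "(\<Sum>k<d. (\<lambda>i. real_of_int (a k) * e k i)) i = (\<Sum>k<d. real_of_int (a k) * e k i)"
        by (induction d) auto
      also have "\<dots> = V a i"
        by (simp add: V_def e_def if_distrib[of "\<lambda>u. _ * u"] cong: if_cong)
      finally show "V a i = (\<Sum>k<d. (\<lambda>i. real_of_int (a k) * e k i)) i" ..
    qed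
    also have "\<dots> \<in> real_funs.span (e ` {..<d})"
      by (intro real_funs.span_sum real_funs.span_scale real_funs.span_base) auto
    finally show ?thesis .
  qed
  have card_e: "card (e ` {..<d}) \<le> d" using card_image_le[of "{..<d}" e] by simp
  obtain B where B: "B \<subseteq> V ` I" "real_funs.independent B" "V ` I \<subseteq> real_funs.span B"
    using real_funs.maximal_independent_subset by blast
  obtain J where J: "J \<subseteq> I" "inj_on V J" "B = V ` J"
    using B(1) by (meson subset_image_inj)
  have bound: "finite S \<and> card S \<le> d"
    if "real_funs.independent S" "S \<subseteq> real_funs.span (e ` {..<d})" for S
    using real_funs.independent_span_bound[OF _ that] card_e by auto
  have B_span: "B \<subseteq> real_funs.span (e ` {..<d})" using B(1) V_span by blast
  have card_J: "card J = card B" "card B \<le> d" "finite B"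
    using J(3) card_image[OF J(2)] bound[OF B(2) B_span] by auto
  show ?thesis
  proof (cases "card J < d")
    case True
    have "lin d a x = lin d a y" if xy: "\<forall>a\<in>J. lin d a x = lin d a y" and a: "a \<in> I" for x y a
    proof -
      \<comment> \<open>The forms that do not distinguish \<open>x\<close> from \<open>y\<close>
        make up a subspace.\<close>
      have "real_funs.span B \<subseteq> {g. dot g x = dot g y}"
      proof (rule real_funs.span_minimal)
        show "B \<subseteq> {g. dot g x = dot g y}" using xy by (auto simp: J(3) dot_V)
        show "real_funs.subspace {g. dot g x = dot g y}"
          by (auto simp: real_funs.subspace_def dot_add dot_scale dot_0 simp del: zero_fun_def)
      qed
      then have "dot (V a) x = dot (V a) y" using B(3) a by blast
      then show ?thesis by (simp add: dot_V)
    qed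
    then show ?thesis using True J(1) by blast
  next
    case False
    then have card_B: "card B = d" using card_J by linarith
    define bnd where "bnd g D \<longleftrightarrow> (\<forall>x t. (\<forall>a\<in>I. \<bar>lin d a x\<bar> \<le> t) \<longrightarrow>
        \<bar>dot g x\<bar> \<le> D * real_of_int t)" for g D
    have span_bnd: "real_funs.span B \<subseteq> {g. \<exists>D. bnd g D}"
    proof (rule real_funs.span_minimal)
      have "bnd (V a) 1" if "a \<in> J" for a
      proof -
        have "\<bar>dot (V a) x\<bar> \<le> 1 * real_of_int t" if "\<forall>a\<in>I. \<bar>lin d a x\<bar> \<le> t" for x t
        proof -
          have "\<bar>lin d a x\<bar> \<le> t" using that \<open>a \<in> J\<close> J(1) by blast
          then show ?thesis by (simp add: dot_V flip: of_int_abs)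
        qed
        then show ?thesis by (simp add: bnd_def)
      qed
      then show "B \<subseteq> {g. \<exists>D. bnd g D}" by (auto simp: J(3))
      show "real_funs.subspace {g. \<exists>D. bnd g D}"
        unfolding real_funs.subspace_def
      proof (safe, goal_cases)
        case 1
        show ?case by (intro exI[of _ 0]) (simp add: bnd_def dot_0 del: zero_fun_def)
      next
        case (2 g h D D')
        have "bnd (g + h) (D + D')"
          unfolding bnd_def dot_add
        proof (intro allI impI)
          fix x t assume xt: "\<forall>a\<in>I. \<bar>lin d a x\<bar> \<le> t"
          then have "\<bar>dot g x\<bar> \<le> D * real_of_int t" "\<bar>dot h x\<bar> \<le> D' * real_of_int t"
            using 2 by (auto simp: bnd_def)
          then show "\<bar>dot g x + dot h x\<bar> \<le> (D + D') * real_of_int t"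
            by (simp add: distrib_right)
        qed
        then show ?case by blast
      next
        case (3 r g D)
        have "bnd (\<lambda>i. r * g i) (\<bar>r\<bar> * D)"
          using 3 by (auto simp: bnd_def dot_scale abs_mult mult.assoc intro: mult_left_mono)
        then show ?case by blast
      qed
    qed
    \<comment> \<open>Otherwise \<open>B\<close> and \<open>e k\<close> would be
      \<open>d + 1\<close> independent vectors in a span of \<open>d\<close> vectors.\<close>
    have "e k \<in> real_funs.span B" if "k < d" for k
    proof (rule ccontr)
      assume no: "e k \<notin> real_funs.span B"
      then have "real_funs.independent (insert (e k) B)"
        using B(2) by (rule real_funs.independent_insertI)
      moreover have "insert (e k) B \<subseteq> real_funs.span (e ` {..<d})"
        using B_span that by (auto intro: real_funs.span_base)
      ultimately have "card (insert (e k) B) \<le> d" using bound by blast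
      moreover have "e k \<notin> B" using no real_funs.span_base by blast
      ultimately show False using card_B card_J(3) by simp
    qed
    then have "\<forall>k\<in>{..<d}. \<exists>D. bnd (e k) D" using span_bnd by blast
    then obtain D where D: "\<And>k. k < d \<Longrightarrow> bnd (e k) (D k)" by (metis lessThan_iff)
    have "real_of_int \<bar>x k\<bar> \<le> (\<Sum>k<d. \<bar>D k\<bar>) * real_of_int t"
      if xt: "\<forall>a\<in>I. \<bar>lin d a x\<bar> \<le> t" and k: "k < d" for x t k
    proof -
      have "I \<noteq> {}" using card_B k J by auto
      then have "t \<ge> 0" using xt by fastforce
      have "real_of_int \<bar>x k\<bar> \<le> D k * real_of_int t"
        using D[OF k] xt k by (auto simp: bnd_def dot_e)
      also have "D k \<le> (\<Sum>k<d. \<bar>D k\<bar>)"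
        using k member_le_sum[of k "{..<d}" "\<lambda>k. \<bar>D k\<bar>"] by simp
      finally show ?thesis using \<open>t \<ge> 0\<close> by (simp add: mult_right_mono)
    qed
    then show ?thesis by blast
  qed
qed

section \<open>Encoding blocks by residues and positions relative to hyperplanes\<close>

lemma max_norm_ge_iff:
  assumes "length x = d" "d \<ge> 1"
  shows "L \<le> max_norm x \<longleftrightarrow> (\<exists>i<d. L \<le> \<bar>x ! i\<bar>)"
proof -
  have "x \<noteq> []" using assms by auto
  then have "L \<le> max_norm x \<longleftrightarrow> (\<exists>y\<in>set x. L \<le> \<bar>y\<bar>)"
    unfolding max_norm_def by (subst Max_ge_iff) auto
  then show ?thesis using assms by (auto simp: in_set_conv_nth Bex_def)
qed

lemma map2_plus_map:
  "length v = d \<Longrightarrow> map2 (+) (map x [0..<d]) v = map (\<lambda>i. x i + v ! i) [0..<d]" for x :: "nat \<Rightarrow> int"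
  by (intro nth_equalityI) auto

lemma int_box_eq: "int_box d n = {v. set v \<subseteq> {0..int n - 1} \<and> length v = d}"
  by (auto simp: int_box_def int_vecs_def)

lemma finite_int_box: "finite (int_box d n)"
  unfolding int_box_eq by (rule finite_lists_length_eq) simp

lemma card_int_box: "card (int_box d n) = n ^ d"
  unfolding int_box_eq by (subst card_lists_length_eq) auto

lemma finite_blocks: "finite (range (\<lambda>x. block d M x n))"
proof (rule finite_subset)
  show "range (\<lambda>x. block d M x n) \<subseteq> int_box d n \<rightarrow>\<^sub>E {0, 1}"
    by (auto simp: block_def PiE_def extensional_def indicator_def)
  show "finite (int_box d n \<rightarrow>\<^sub>E {0, 1::nat})"
    by (intro finite_PiE finite_int_box) simp
qed

lemma card_image_le_code:
  assumes "finite T" "code ` X \<subseteq> T" "\<And>x y. x \<in> X \<Longrightarrow> y \<in> X \<Longrightarrow> code x = code y \<Longrightarrow> g x = g y"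
  shows "card (g ` X) \<le> card T"
proof -
  have "g x = g (inv_into X code (code x))" if "x \<in> X" for x
    using assms(3) that by (metis f_inv_into_f imageI inv_into_into)
  then have "g ` X \<subseteq> (\<lambda>c. g (inv_into X code c)) ` T" using assms(2) by blast
  then show ?thesis using assms(1) by (meson card_image_le card_mono finite_imageI le_trans)
qed

text \<open>A block at \<open>x\<close> is determined by the residues of \<open>x\<close>, the
  normals whose form is small at \<open>x\<close>, the sides taken for the others, and the small
  values. Far out the small forms have rank below \<open>d\<close>, so at most \<open>d - 1\<close>
  values of size \<open>O(n)\<close> have to be recorded.\<close>

lemma recurrent_complexity_bound:
  assumes d: "d \<ge> 1" and qa: "quasi_affine d (\<lambda>x. map x [0..<d] \<in> M)"
  shows "\<exists>c. \<forall>n\<ge>1. recurrent_complexity d M n \<le> c * n ^ (d - 1)"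
proof -
  obtain H N where H: "finite H" "N > 0"
    "\<And>x y. same_cell d H N x y \<Longrightarrow> map x [0..<d] \<in> M \<longleftrightarrow> map y [0..<d] \<in> M"
    using qa unfolding quasi_affine_def by blast
  define V where "V = fst ` H"
  have finV: "finite V" using H(1) by (simp add: V_def)
  \<comment> \<open>For \<open>n \<ge> 1\<close>, \<open>C * n\<close> exceeds both what any of the
    forms can vary over a box of size \<open>n\<close> and its threshold, taken together.\<close>
  define C where "C = (\<Sum>(a, b)\<in>H. (\<Sum>i<d. \<bar>a i\<bar>) + \<bar>b\<bar>)"
  have C: "(\<Sum>i<d. \<bar>a i\<bar>) + \<bar>b\<bar> \<le> C" if "(a, b) \<in> H" for a b
    using member_le_sum[OF that, of "\<lambda>(a, b). (\<Sum>i<d. \<bar>a i\<bar>) + \<bar>b\<bar>"] H(1)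
    by (auto simp: C_def sum_nonneg)
  have C0: "C \<ge> 0" unfolding C_def by (intro sum_nonneg) (auto simp: sum_nonneg)
  define low_rank where "low_rank I J \<longleftrightarrow> J \<subseteq> I \<and> card J < d \<and>
      (\<forall>x y. (\<forall>a\<in>J. lin d a x = lin d a y) \<longrightarrow> (\<forall>a\<in>I. lin d a x = lin d a y))" for I J
  define basis where "basis I = (SOME J. low_rank I J)" for I
  define LR where "LR = {I. I \<subseteq> V \<and> (\<exists>J. low_rank I J)}"
  have basis: "low_rank I (basis I)" if "I \<in> LR" for I
    using that someI_ex[of "low_rank I"] by (simp add: basis_def LR_def)
  have finLR: "finite LR" "card LR \<le> 2 ^ card V"
    using finV card_mono[of "Pow V" LR] by (auto simp: LR_def card_Pow intro: finite_subset[of _ "Pow V"])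
  define bounded where "bounded I D \<longleftrightarrow> (\<forall>x t. (\<forall>a\<in>I. \<bar>lin d a x\<bar> \<le> t) \<longrightarrow>
      (\<forall>i<d. real_of_int \<bar>x i\<bar> \<le> D * real_of_int t))" for I and D :: real
  define D where "D I = (SOME D. bounded I D)" for I
  have D: "bounded I (D I)" if "I \<in> Pow V - LR" for I
  proof -
    have fin: "finite I" using that finV by (auto intro: finite_subset)
    have "\<exists>D. bounded I D"
      using rank_dichotomy[OF fin, of d]
    proof (rule disjE, goal_cases)
      case 1
      then have "\<exists>J. low_rank I J" unfolding low_rank_def by blast
      then show ?case using that by (simp add: LR_def)
    next
      case 2
      then show ?case by (simp add: bounded_def)
    qed
    then show ?thesis unfolding D_def by (rule someI_ex)
  qed
  \<comment> \<open>The factors count residues, near sets, positive sides, and the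
    \<open>n\<close>-free part of \<open>(2 t + 1)^(d - 1)\<close>.\<close>
  define c where "c = nat N ^ d * (2 ^ card V * (2 ^ card V * nat (2 * C + 1) ^ (d - 1)))"
  have "recurrent_complexity d M n \<le> c * n ^ (d - 1)" if n: "n \<ge> 1" for n
  proof -
    define t where "t = C * int n"
    have t0: "t \<ge> 0" using C0 by (simp add: t_def)
    define near where "near x = {a \<in> V. \<bar>lin d a x\<bar> \<le> t}" for x
    define pos where "pos x = {a \<in> V. t < lin d a x}" for x
    define code where "code x = ((\<lambda>i\<in>{..<d}. x i mod N), near x, pos x,
        (\<lambda>a\<in>basis (near x). lin d a x))" for x
    define X where "X = {x. near x \<in> LR}"
    \<comment> \<open>A dependent sum, because the domain of the recorded values is a basis of the
      near set.\<close>
    define T where "T = ({..<d} \<rightarrow>\<^sub>E {0..<N}) \<times>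
        (SIGMA I:LR. Pow V \<times> (basis I \<rightarrow>\<^sub>E {-t..t}))"
    define bl where "bl x = block d M (map x [0..<d]) n" for x
    have sub: "basis I \<subseteq> I" "card (basis I) \<le> d - 1" "finite (basis I)" if "I \<in> LR" for I
    proof -
      have "basis I \<subseteq> I \<and> card (basis I) < d" using basis[OF that] unfolding low_rank_def by blast
      moreover have "I \<subseteq> V" using that by (simp add: LR_def)
      ultimately show "basis I \<subseteq> I" "card (basis I) \<le> d - 1" "finite (basis I)"
        using finite_subset[OF _ finV, of "basis I"] by auto
    qed
    have code_T: "code ` X \<subseteq> T"
    proof
      fix z assume "z \<in> code ` X"
      then obtain x where x: "z = code x" "near x \<in> LR" by (auto simp: X_def)
      have "\<bar>lin d a x\<bar> \<le> t" if "a \<in> basis (near x)" for a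
        using sub(1)[OF x(2)] that by (auto simp: near_def)
      then have "(\<lambda>a\<in>basis (near x). lin d a x) \<in> basis (near x) \<rightarrow>\<^sub>E {-t..t}"
        by (fastforce simp: restrict_PiE_iff abs_le_iff)
      moreover have "(\<lambda>i\<in>{..<d}. x i mod N) \<in> {..<d} \<rightarrow>\<^sub>E {0..<N}"
        using H(2) by (simp add: restrict_PiE_iff)
      moreover have "pos x \<in> Pow V" by (auto simp: pos_def)
      ultimately show "z \<in> T"
        unfolding T_def x(1) code_def using x(2) by (simp only: mem_Sigma_iff simp_thms)
    qed
    have finT: "finite T"
      unfolding T_def using finV
      by (intro finite_cartesian_product finite_PiE finite_SigmaI finLR(1) sub(3)) simp_all
    have bl_code: "bl x = bl y" if xy: "x \<in> X" "y \<in> X" "code x = code y" for x y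
    proof -
      have eqs: "near x = near y" "pos x = pos y" "\<And>i. i < d \<Longrightarrow> x i mod N = y i mod N"
        using xy(3) by (auto simp: code_def restrict_def fun_eq_iff split: if_splits)
      have "lin d a x = lin d a y" if "a \<in> basis (near x)" for a
        using xy(3) that by (auto simp: code_def restrict_def fun_eq_iff eqs(1) split: if_splits)
      moreover have "low_rank (near x) (basis (near x))" using basis xy(1) by (simp add: X_def)
      ultimately have near_eq: "lin d a x = lin d a y" if "a \<in> near x" for a
        using that unfolding low_rank_def by blast
      have "indicator M (map2 (+) (map x [0..<d]) v) = (indicator M (map2 (+) (map y [0..<d]) v) :: nat)"
        if v: "v \<in> int_box d n" for v
      proof -
        have len: "length v = d" and "set v \<subseteq> {0..int n - 1}"
          using v by (auto simp: int_box_def int_vecs_def)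
        then have v_bd: "v ! i \<in> {0..int n - 1}" if "i < d" for i
          using that nth_mem by blast
        let ?x = "\<lambda>i. x i + v ! i" and ?y = "\<lambda>i. y i + v ! i"
        have lin_add: "lin d a (\<lambda>i. z i + v ! i) = lin d a z + lin d a (\<lambda>i. v ! i)" for a z
          by (simp add: lin_def distrib_left sum.distrib)
        have "same_cell d H N ?x ?y"
          unfolding same_cell_def
        proof (intro conjI ballI allI impI)
          fix h assume h: "h \<in> H"
          obtain a b where ab: "h = (a, b)" by force
          have aV: "a \<in> V" using h ab by (force simp: V_def)
          have "\<bar>lin d a (\<lambda>i. v ! i)\<bar> \<le> (\<Sum>i<d. \<bar>a i\<bar> * int n)"
            unfolding lin_def
          proof (rule order_trans[OF sum_abs sum_mono])
            fix i assume "i \<in> {..<d}"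
            then have "\<bar>v ! i\<bar> \<le> int n" using v_bd[of i] by auto
            then show "\<bar>a i * v ! i\<bar> \<le> \<bar>a i\<bar> * int n" by (simp add: abs_mult mult_left_mono)
          qed
          moreover have "\<bar>b\<bar> \<le> \<bar>b\<bar> * int n" using n mult_left_mono[of 1 "int n" "\<bar>b\<bar>"] by simp
          moreover have "((\<Sum>i<d. \<bar>a i\<bar>) + \<bar>b\<bar>) * int n \<le> t"
            unfolding t_def using C h ab by (intro mult_right_mono) auto
          ultimately have small: "\<bar>lin d a (\<lambda>i. v ! i)\<bar> + \<bar>b\<bar> \<le> t"
            by (simp add: sum_distrib_right distrib_right)
          have "lin d a ?x \<le> b \<longleftrightarrow> lin d a ?y \<le> b"
          proof (cases "a \<in> near x")
            case True
            then show ?thesis by (simp add: lin_add near_eq)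
          next
            \<comment> \<open>A form exceeding \<open>t\<close> in absolute value keeps its side of
              the threshold throughout the box.\<close>
            case far: False
            show ?thesis
            proof (cases "a \<in> pos x")
              case True
              then have "t < lin d a x" "t < lin d a y" using eqs(2) by (auto simp: pos_def)
              then have "b < lin d a ?x" "b < lin d a ?y" using small unfolding lin_add by linarith+
              then show ?thesis by simp
            next
              case False
              have "a \<notin> near y" "a \<notin> pos y" using far False eqs(1,2) by simp_all
              then have "lin d a x < - t" "lin d a y < - t"
                using far False aV by (auto simp: pos_def near_def)
              then have "lin d a ?x \<le> b" "lin d a ?y \<le> b" using small unfolding lin_add by linarith+
              then show ?thesis by simp
            qed
          qed
          then show "case h of (a, b) \<Rightarrow> lin d a ?x \<le> b \<longleftrightarrow> lin d a ?y \<le> b" by (simp add: ab)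
        next
          fix i assume "i < d"
          then show "[x i + v ! i = y i + v ! i] (mod N)"
            using eqs(3) by (auto simp: cong_def intro: mod_add_cong)
        qed
        from H(3)[OF this] show ?thesis by (simp add: map2_plus_map[OF len] indicator_def)
      qed
      then show ?thesis by (auto simp: bl_def block_def restrict_def fun_eq_iff)
    qed
    have "card (bl ` X) \<le> card T" by (rule card_image_le_code[OF finT code_T bl_code])
    have finbl: "finite (bl ` X)"
      by (rule finite_subset[OF _ finite_blocks]) (auto simp: bl_def)
    have "{B. recurrent_block d M n B} \<subseteq> bl ` X"
    proof
      fix B assume "B \<in> {B. recurrent_block d M n B}"
      then have B: "\<And>L::nat. \<exists>x\<in>int_vecs d. max_norm x \<ge> int L \<and> block d M x n = B"
        by (simp add: recurrent_block_def)
      \<comment> \<open>If the near set had full rank, the coordinates of \<open>x\<close> would be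
        at most one of the finitely many \<open>D I * t\<close>; \<open>L\<close> exceeds all of
        them.\<close>
      define L where "L = nat (\<lceil>\<Sum>I\<in>Pow V. \<bar>D I * real_of_int t\<bar>\<rceil> + 1)"
      obtain xs where xs: "length xs = d" "max_norm xs \<ge> int L" "block d M xs n = B"
        using B[of L] by (auto simp: int_vecs_def)
      define x where "x = nth xs"
      have xs_x: "xs = map x [0..<d]" using xs(1) map_nth[of xs] by (simp add: x_def)
      obtain i where i: "i < d" "int L \<le> \<bar>x i\<bar>"
        using xs(2) max_norm_ge_iff[OF xs(1) d] unfolding x_def by blast
      have "near x \<in> LR"
      proof (rule ccontr)
        assume "near x \<notin> LR"
        then have nx: "near x \<in> Pow V - LR" by (auto simp: near_def)
        have "real_of_int \<bar>x i\<bar> \<le> D (near x) * real_of_int t"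
          using D[OF nx] i(1) unfolding bounded_def by (auto simp: near_def)
        also have "\<dots> \<le> (\<Sum>I\<in>Pow V. \<bar>D I * real_of_int t\<bar>)"
          using member_le_sum[of "near x" "Pow V" "\<lambda>I. \<bar>D I * real_of_int t\<bar>"] nx finV by auto
        also have "\<dots> < real_of_int (int L)"
          unfolding L_def by (simp add: sum_nonneg) linarith
        finally show False using i(2) by linarith
      qed
      then show "B \<in> bl ` X" using xs(3) xs_x by (auto simp: bl_def X_def)
    qed
    then have "recurrent_complexity d M n \<le> card (bl ` X)"
      unfolding recurrent_complexity_def using finbl by (rule card_mono[rotated])
    also note \<open>card (bl ` X) \<le> card T\<close>
    also have "card T \<le> c * n ^ (d - 1)"
    proof -
      have "card (basis I \<rightarrow>\<^sub>E {-t..t}) \<le> nat (2 * C + 1) ^ (d - 1) * n ^ (d - 1)" if "I \<in> LR" for I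
      proof -
        have "card (basis I \<rightarrow>\<^sub>E {-t..t}) = nat (2 * t + 1) ^ card (basis I)"
          using sub[OF that] by (simp add: card_PiE)
        also have "\<dots> \<le> nat (2 * t + 1) ^ (d - 1)"
          using sub[OF that] t0 by (intro power_increasing) auto
        also have "\<dots> \<le> (nat (2 * C + 1) * n) ^ (d - 1)"
        proof (rule power_mono)
          have "2 * t + 1 \<le> (2 * C + 1) * int n" using n by (simp add: t_def algebra_simps)
          then have "nat (2 * t + 1) \<le> nat ((2 * C + 1) * int n)" by (rule nat_mono)
          then show "nat (2 * t + 1) \<le> nat (2 * C + 1) * n" using C0 by (simp add: nat_mult_distrib)
        qed simp
        finally show ?thesis by (simp add: power_mult_distrib)
      qed
      then have fibre: "card (Pow V \<times> (basis I \<rightarrow>\<^sub>E {-t..t})) \<le>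
          2 ^ card V * (nat (2 * C + 1) ^ (d - 1) * n ^ (d - 1))" if "I \<in> LR" for I
        using that finV by (simp add: card_cartesian_product card_Pow)
      have "finite (Pow V \<times> (basis I \<rightarrow>\<^sub>E {-t..t}))" if "I \<in> LR" for I
        using finV sub(3)[OF that] by (intro finite_cartesian_product finite_PiE) simp_all
      then have "card (SIGMA I:LR. Pow V \<times> (basis I \<rightarrow>\<^sub>E {-t..t})) =
          (\<Sum>I\<in>LR. card (Pow V \<times> (basis I \<rightarrow>\<^sub>E {-t..t})))"
        by (intro card_SigmaI finLR(1)) blast
      also have "\<dots> \<le> card LR * (2 ^ card V * (nat (2 * C + 1) ^ (d - 1) * n ^ (d - 1)))"
        using sum_bounded_above[OF fibre, of LR] by simp
      also have "\<dots> \<le> 2 ^ card V * (2 ^ card V * (nat (2 * C + 1) ^ (d - 1) * n ^ (d - 1)))"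
        using finLR(2) by (rule mult_le_mono1)
      finally have "card ({..<d} \<rightarrow>\<^sub>E {0..<N}) * card (SIGMA I:LR. Pow V \<times> (basis I \<rightarrow>\<^sub>E {-t..t})) \<le>
          nat N ^ d * (2 ^ card V * (2 ^ card V * (nat (2 * C + 1) ^ (d - 1) * n ^ (d - 1))))"
        by (intro mult_le_mono) (simp_all add: card_PiE)
      then show ?thesis
        by (simp only: T_def c_def card_cartesian_product mult.assoc)
    qed
    finally show ?thesis .
  qed
  then show ?thesis by blast
qed

section \<open>Sections\<close>

lemma mem_section_at_iff:
  assumes "i \<le> length zs"
  shows "zs \<in> section_at (Suc i) c M \<longleftrightarrow> take i zs @ c # drop i zs \<in> M"
proof
  assume "zs \<in> section_at (Suc i) c M"
  then obtain xs ys where "zs = xs @ ys" "length xs = i" "xs @ c # ys \<in> M"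
    by (auto simp: section_at_def)
  then show "take i zs @ c # drop i zs \<in> M" by auto
next
  assume "take i zs @ c # drop i zs \<in> M"
  then show "zs \<in> section_at (Suc i) c M"
    using assms unfolding section_at_def
    by (intro CollectI exI[of _ "take i zs"] exI[of _ "drop i zs"]) auto
qed

lemma insert_coordinate:
  assumes "i < d"
  shows "take i (map x [0..<d - 1]) @ c # drop i (map x [0..<d - 1]) =
    map (\<lambda>j. if j < i then x j else if j = i then c else x (j - 1)) [0..<d]"
  using assms by (intro nth_equalityI) (auto simp: nth_append nth_Cons' min_def)

lemma section_at_map_iff:
  assumes "i < d"
  shows "map x [0..<d - 1] \<in> section_at (Suc i) c M \<longleftrightarrow>
    map (\<lambda>j. if j < i then x j else if j = i then c else x (j - 1)) [0..<d] \<in> M"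
proof -
  have "i \<le> length (map x [0..<d - 1])" using assms by simp
  then show ?thesis by (simp only: mem_section_at_iff insert_coordinate[OF assms])
qed

lemma presburger_definable_section:
  assumes M: "presburger_definable d M" and i: "i < d"
  shows "presburger_definable (d - 1) (section_at (Suc i) c M)"
  unfolding presburger_definable_iff
proof
  have "M \<subseteq> int_vecs d" using M by (simp add: presburger_definable_iff)
  then show "section_at (Suc i) c M \<subseteq> int_vecs (d - 1)"
    by (fastforce simp: section_at_def int_vecs_def)
  have defM: "definable d (\<lambda>x. map x [0..<d] \<in> M)" using M by (simp add: presburger_definable_iff)
  have "definable_fun (d - 1) (\<lambda>x. if j < i then x j else if j = i then c else x (j - 1))" if "j < d" for j
    using i that by (cases "j < i"; cases "j = i") (auto intro: definable_fun_var definable_fun_const)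
  from definable_subst[OF defM this]
  show "definable (d - 1) (\<lambda>x. map x [0..<d - 1] \<in> section_at (Suc i) c M)"
    unfolding section_at_map_iff[OF i] .
qed

text \<open>The renaming skips coordinate \<open>i\<close>; the conjunct \<open>x i = c\<close>
  restores the lost information.\<close>

lemma definable_slice:
  assumes sec: "presburger_definable (d - 1) (section_at (Suc i) c M)" and i: "i < d"
  shows "definable d (\<lambda>x. x i = c \<and> map x [0..<d] \<in> M)"
proof -
  have defsec: "definable (d - 1) (\<lambda>x. map x [0..<d - 1] \<in> section_at (Suc i) c M)"
    using sec by (simp add: presburger_definable_iff)
  have "definable d (\<lambda>x. map (\<lambda>j. x (if j < i then j else Suc j)) [0..<d - 1] \<in> section_at (Suc i) c M)"
    by (rule definable_rename[OF defsec, where r="\<lambda>j. if j < i then j else Suc j"]) (use i in auto)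
  then have "definable d (\<lambda>x. x i = c \<and>
      map (\<lambda>j. x (if j < i then j else Suc j)) [0..<d - 1] \<in> section_at (Suc i) c M)"
    using i by (intro definable_conj definable_eq[of _ _ "\<lambda>_. c"] definable_fun_intros)
  moreover have "x i = c \<and> map (\<lambda>j. x (if j < i then j else Suc j)) [0..<d - 1] \<in> section_at (Suc i) c M
      \<longleftrightarrow> x i = c \<and> map x [0..<d] \<in> M" for x
  proof (rule conj_cong[OF refl])
    assume "x i = c"
    then have "map (\<lambda>j. if j < i then x (if j < i then j else Suc j)
        else if j = i then c else x (if j - 1 < i then j - 1 else Suc (j - 1))) [0..<d] = map x [0..<d]"
      by (intro map_cong) auto
    then show "map (\<lambda>j. x (if j < i then j else Suc j)) [0..<d - 1] \<in> section_at (Suc i) c M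
        \<longleftrightarrow> map x [0..<d] \<in> M"
      unfolding section_at_map_iff[OF i] by (simp only:)
  qed
  ultimately show ?thesis by simp
qed

section \<open>An annihilator from low complexity\<close>

text \<open>Fraction-free Gaussian elimination: the pivot \<open>w\<close> of the last equation is
  removed by cross multiplication, so all coefficients remain integers.\<close>

lemma homogeneous_solution:
  fixes b :: "nat \<Rightarrow> 'v \<Rightarrow> int"
  assumes "finite V" "k < card V"
  shows "\<exists>\<phi>. (\<exists>v\<in>V. \<phi> v \<noteq> 0) \<and> (\<forall>j<k. (\<Sum>v\<in>V. \<phi> v * b j v) = 0)"
  using assms
proof (induction k arbitrary: V b)
  case 0
  then obtain v where "v \<in> V" by (metis card.empty equals0I less_irrefl)
  then show ?case by (intro exI[of _ "\<lambda>_. 1"]) auto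
next
  case (Suc k)
  show ?case
  proof (cases "\<forall>v\<in>V. b k v = 0")
    case True
    obtain \<phi> where \<phi>: "\<exists>v\<in>V. \<phi> v \<noteq> 0" "\<forall>j<k. (\<Sum>v\<in>V. \<phi> v * b j v) = 0"
      using Suc.IH[of V b] Suc.prems by auto
    then show ?thesis using True by (intro exI[of _ \<phi>]) (auto simp: less_Suc_eq)
  next
    case False
    then obtain w where w: "w \<in> V" "b k w \<noteq> 0" by blast
    define b' where "b' j v = b k w * b j v - b j w * b k v" for j v
    have "k < card (V - {w})" using Suc.prems w by (simp add: card_Diff_singleton)
    then obtain \<psi> where \<psi>: "\<exists>v\<in>V - {w}. \<psi> v \<noteq> 0" "\<forall>j<k. (\<Sum>v\<in>V - {w}. \<psi> v * b' j v) = 0"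
      using Suc.IH[of "V - {w}" b'] Suc.prems by auto
    \<comment> \<open>The entry at \<open>w\<close> is chosen so that the last equation holds; the
      other entries are scaled by the pivot \<open>b k w\<close>, which keeps them nonzero.\<close>
    define \<phi> where "\<phi> v = (if v = w then - (\<Sum>v\<in>V - {w}. \<psi> v * b k v) else b k w * \<psi> v)" for v
    have sum: "(\<Sum>v\<in>V. \<phi> v * b j v) = (\<Sum>v\<in>V - {w}. \<psi> v * b' j v)" for j
    proof -
      have "(\<Sum>v\<in>V. \<phi> v * b j v) = \<phi> w * b j w + (\<Sum>v\<in>V - {w}. \<phi> v * b j v)"
        using Suc.prems w by (simp add: sum.remove)
      also have "(\<Sum>v\<in>V - {w}. \<phi> v * b j v) = (\<Sum>v\<in>V - {w}. \<psi> v * (b k w * b j v))"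
        by (rule sum.cong) (auto simp: \<phi>_def)
      also have "\<phi> w * b j w = - (\<Sum>v\<in>V - {w}. \<psi> v * (b j w * b k v))"
        by (simp add: \<phi>_def sum_distrib_left ac_simps)
      finally show ?thesis
        by (simp add: b'_def right_diff_distrib sum_subtractf)
    qed
    have "(\<Sum>v\<in>V. \<phi> v * b j v) = 0" if "j < Suc k" for j
      using that \<psi>(2) unfolding sum by (cases "j = k") (auto simp: b'_def mult.commute)
    moreover have "\<exists>v\<in>V. \<phi> v \<noteq> 0" using \<psi>(1) w by (auto simp: \<phi>_def)
    ultimately show ?thesis by blast
  qed
qed

text \<open>There are finitely many blocks of size \<open>n\<close>, and each non-recurrent one
  stops occurring beyond some bound; the sum of these bounds serves for all.\<close>

lemma far_blocks_recurrent:
  "\<exists>L::nat. \<forall>x\<in>int_vecs d. int L \<le> max_norm x \<longrightarrow> recurrent_block d M n (block d M x n)"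
proof -
  define Bs where "Bs = {B \<in> range (\<lambda>x. block d M x n). \<not> recurrent_block d M n B}"
  have "finite Bs" using finite_blocks by (simp add: Bs_def)
  have "\<forall>B\<in>Bs. \<exists>L::nat. \<forall>x\<in>int_vecs d. int L \<le> max_norm x \<longrightarrow> block d M x n \<noteq> B"
    by (auto simp: Bs_def recurrent_block_def)
  then obtain L :: "(int list \<Rightarrow> nat) \<Rightarrow> nat" where
    L: "\<forall>B\<in>Bs. \<forall>x\<in>int_vecs d. int (L B) \<le> max_norm x \<longrightarrow> block d M x n \<noteq> B"
    by (rule bchoice[THEN exE])
  have "recurrent_block d M n (block d M x n)"
    if x: "x \<in> int_vecs d" "int (\<Sum>B\<in>Bs. L B) \<le> max_norm x" for x
  proof (rule ccontr)
    assume "\<not> ?thesis"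
    then have B: "block d M x n \<in> Bs" by (auto simp: Bs_def)
    then have "L (block d M x n) \<le> (\<Sum>B\<in>Bs. L B)"
      using \<open>finite Bs\<close> by (intro member_le_sum) auto
    then have "int (L (block d M x n)) \<le> max_norm x" using x(2) by linarith
    then show False using L B x(1) by blast
  qed
  then show ?thesis by blast
qed

text \<open>With fewer recurrent blocks than positions in a box, some nonzero integer combination of
  the entries kills every recurrent block. As all far blocks are recurrent, it is an annihilator of
  the indicator function up to bounded support.\<close>

lemma definable_of_low_complexity:
  assumes d: "d \<ge> 1" and R: "recurrent_complexity d M n < n ^ d"
    and sec: "\<And>i c. i < d \<Longrightarrow> presburger_definable (d - 1) (section_at (Suc i) c M)"
  shows "definable d (\<lambda>x. map x [0..<d] \<in> M)"
proof -
  define f :: "(nat \<Rightarrow> int) \<Rightarrow> int" where "f x = of_bool (map x [0..<d] \<in> M)" for x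
  define Rec where "Rec = {B. recurrent_block d M n B}"
  have "Rec \<subseteq> range (\<lambda>x. block d M x n)"
    unfolding Rec_def recurrent_block_def by blast
  then have "finite Rec" using finite_blocks by (rule finite_subset)
  then obtain e where e: "bij_betw e {0..<card Rec} Rec"
    using ex_bij_betw_nat_finite by blast
  have "card Rec < card (int_box d n)"
    using R by (simp add: Rec_def recurrent_complexity_def card_int_box)
  then obtain \<phi> where nz: "\<exists>v\<in>int_box d n. \<phi> v \<noteq> 0"
    and \<phi>: "\<forall>j<card Rec. (\<Sum>v\<in>int_box d n. \<phi> v * int (e j v)) = 0"
    using homogeneous_solution[OF finite_int_box, of "card Rec" d n "\<lambda>j v. int (e j v)"] by blast
  have kill: "(\<Sum>v\<in>int_box d n. \<phi> v * int (B v)) = 0" if "recurrent_block d M n B" for B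
  proof -
    have "B \<in> e ` {0..<card Rec}" using that e by (simp add: Rec_def bij_betw_def)
    then show ?thesis using \<phi> by auto
  qed
  \<comment> \<open>Padding by 0 ensures that distinct exponents differ at some index below
    \<open>d\<close>.\<close>
  define vec where "vec v = (\<lambda>i. if i < d then v ! i else 0)" for v :: "int list"
  have vec_inv: "map (vec v) [0..<d] = v" if "v \<in> int_box d n" for v
  proof -
    have "length v = d" using that by (simp add: int_box_eq)
    then show ?thesis by (intro nth_equalityI) (auto simp: vec_def)
  qed
  have inj: "inj_on vec (int_box d n)" by (metis inj_onI vec_inv)
  define S where "S = vec ` int_box d n"
  define c where "c a = \<phi> (map a [0..<d])" for a
  have finS: "finite S" by (simp add: S_def finite_int_box)
  obtain L :: nat where L: "\<And>x. x \<in> int_vecs d \<Longrightarrow> int L \<le> max_norm x \<Longrightarrow>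
      recurrent_block d M n (block d M x n)"
    using far_blocks_recurrent by blast
  have far: "(\<Sum>a\<in>S. c a * f (x + a)) = 0" if "\<exists>i<d. int L \<le> \<bar>x i\<bar>" for x
  proof -
    let ?x = "map x [0..<d]"
    have "int L \<le> max_norm ?x" using that max_norm_ge_iff[of ?x d "int L"] d by auto
    then have rec: "recurrent_block d M n (block d M ?x n)" by (intro L) (simp add: int_vecs_def)
    have "(\<Sum>a\<in>S. c a * f (x + a)) = (\<Sum>v\<in>int_box d n. c (vec v) * f (x + vec v))"
      unfolding S_def by (simp add: sum.reindex[OF inj])
    also have "\<dots> = (\<Sum>v\<in>int_box d n. \<phi> v * int (block d M ?x n v))"
    proof (rule sum.cong[OF refl])
      fix v assume v: "v \<in> int_box d n"
      then have "length v = d" by (simp add: int_box_eq)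
      then have "map2 (+) ?x v = map (x + vec v) [0..<d]"
        by (simp add: map2_plus_map vec_def)
      then show "c (vec v) * f (x + vec v) = \<phi> v * int (block d M ?x n v)"
        using v by (simp add: c_def vec_inv f_def block_def indicator_def)
    qed
    finally show ?thesis using kill[OF rec] by simp
  qed
  obtain a0 where a0: "a0 \<in> S" "c a0 \<noteq> 0"
  proof -
    obtain v where "v \<in> int_box d n" "\<phi> v \<noteq> 0" using nz by blast
    then show ?thesis using that[of "vec v"] by (simp add: S_def c_def vec_inv)
  qed
  have "far_zero d (\<lambda>x. \<Sum>a\<in>insert a0 (S - {a0}). c a * f (x + a))"
    unfolding far_zero_def insert_Diff[OF a0(1)] using far by blast
  moreover have "\<bar>f x\<bar> \<le> 1" for x by (simp add: f_def)
  ultimately obtain q where q: "q > 0"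
    "far_zero d (act (\<Prod>a\<in>S - {a0}. mon (scale q a0) 1 - mon (scale q a) 1) f)"
    using far_zero_difference_product[of "S - {a0}" a0 c f 1 d] finS a0(2) by auto
  have "sections_definable d f"
    unfolding sections_definable_def
  proof (intro allI impI)
    fix i k and a :: int assume i: "i < d"
    have slice: "definable d (\<lambda>x. x i = k \<and> map x [0..<d] \<in> M)"
      by (rule definable_slice[OF sec[OF i] i])
    have "definable d (\<lambda>x. x i = k)"
      using i by (intro definable_eq[of _ _ "\<lambda>_. k"] definable_fun_intros)
    \<comment> \<open>The value 0 is taken on the complement of the slice within the hyperplane
      \<open>x i = k\<close>.\<close>
    then have "definable d (\<lambda>x. x i = k \<and> map x [0..<d] \<in> M \<and> a = 1 \<or>
        (x i = k \<and> \<not> (x i = k \<and> map x [0..<d] \<in> M)) \<and> a = 0)"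
      using definable_disj[OF definable_conj[OF slice definable_const]
          definable_conj[OF definable_conj[OF _ definable_not[OF slice]] definable_const], of "\<lambda>x. x i = k"]
      by simp
    moreover have "x i = k \<and> map x [0..<d] \<in> M \<and> a = 1 \<or>
        (x i = k \<and> \<not> (x i = k \<and> map x [0..<d] \<in> M)) \<and> a = 0 \<longleftrightarrow> x i = k \<and> f x = a" for x
      by (auto simp: f_def)
    ultimately show "definable d (\<lambda>x. x i = k \<and> f x = a)" by simp
  qed
  moreover have "finite (range f)"
    by (rule finite_subset[of _ "{0, 1}"]) (auto simp: f_def)
  moreover have "\<exists>i<d. scale q a0 i \<noteq> scale q a i" if "a \<in> S - {a0}" for a
  proof -
    have "a0 \<noteq> a" using that by blast
    then obtain i where i: "a0 i \<noteq> a i" by (auto simp: fun_eq_iff)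
    then have "i < d" using that a0(1) by (auto simp: S_def vec_def split: if_splits)
    then show ?thesis using i q(1) by (auto simp: scale_def)
  qed
  ultimately have "definable d (\<lambda>x. f x = 1)"
    using q(2) finS d by (intro definable_of_annihilator[where S="S - {a0}" and u="scale q a0" and t="scale q"]) auto
  then show ?thesis by (simp add: f_def)
qed

theorem theorem1p2:
  fixes d :: nat and M :: "int list set"
  assumes "d \<ge> 1" and "M \<subseteq> int_vecs d"
  shows "presburger_definable d M \<longleftrightarrow>
    (\<lambda>n. real (recurrent_complexity d M n)) \<in> O(\<lambda>n. real n ^ (d - 1)) \<and>
    (\<forall>i\<in>{1..d}. \<forall>c::int. presburger_definable (d - 1) (section_at i c M))"
proof (intro iffI conjI ballI allI)
  assume M: "presburger_definable d M"
  then have "quasi_affine d (\<lambda>x. map x [0..<d] \<in> M)"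
    by (intro quasi_affine_definable) (simp add: presburger_definable_iff)
  from recurrent_complexity_bound[OF assms(1) this] obtain c where
    c: "\<And>n. n \<ge> 1 \<Longrightarrow> recurrent_complexity d M n \<le> c * n ^ (d - 1)" by blast
  show "(\<lambda>n. real (recurrent_complexity d M n)) \<in> O(\<lambda>n. real n ^ (d - 1))"
  proof (rule bigoI[where c="real c"])
    show "\<forall>\<^sub>F n in at_top. norm (real (recurrent_complexity d M n)) \<le> real c * norm (real n ^ (d - 1))"
      using eventually_ge_at_top[of 1]
    proof eventually_elim
      case (elim n)
      from c[OF elim] have "real (recurrent_complexity d M n) \<le> real (c * n ^ (d - 1))"
        by (rule of_nat_mono)
      then show ?case by simp
    qed
  qed
  fix i c assume "i \<in> {1..d}"
  then have "i - 1 < d" "Suc (i - 1) = i" by auto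
  then show "presburger_definable (d - 1) (section_at i c M)"
    using presburger_definable_section[OF M, of "i - 1" c] by simp
next
  assume rhs: "(\<lambda>n. real (recurrent_complexity d M n)) \<in> O(\<lambda>n. real n ^ (d - 1)) \<and>
    (\<forall>i\<in>{1..d}. \<forall>c::int. presburger_definable (d - 1) (section_at i c M))"
  then obtain c where "c > 0" and
    "\<forall>\<^sub>F n in at_top. norm (real (recurrent_complexity d M n)) \<le> c * norm (real n ^ (d - 1))"
    by (auto elim: landau_o.bigE)
  then have "\<forall>\<^sub>F n in at_top. real (recurrent_complexity d M n) \<le> c * real n ^ (d - 1)" by simp
  moreover have "\<forall>\<^sub>F n in at_top. c < real n"
    using filterlim_real_sequentially by (simp add: filterlim_at_top_dense)
  \<comment> \<open>Once \<open>n\<close> exceeds the constant of the bound,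
    \<open>c * n^(d - 1) < n^d\<close>; a single such \<open>n\<close> is used.\<close>
  ultimately have "\<forall>\<^sub>F n in at_top. recurrent_complexity d M n < n ^ d"
  proof eventually_elim
    case (elim n)
    have "real (recurrent_complexity d M n) \<le> c * real n ^ (d - 1)" by (rule elim(1))
    also have "\<dots> < real n * real n ^ (d - 1)"
      using elim(2) \<open>c > 0\<close> by (intro mult_strict_right_mono) auto
    also have "\<dots> = real (n ^ d)" using assms(1) by (simp flip: power_Suc)
    finally show ?case by (simp only: of_nat_less_iff)
  qed
  then obtain n where n: "recurrent_complexity d M n < n ^ d"
    using eventually_happens by force
  have "definable d (\<lambda>x. map x [0..<d] \<in> M)"
    using rhs by (intro definable_of_low_complexity[OF assms(1) n]) auto
  then show "presburger_definable d M" using assms(2) by (simp add: presburger_definable_iff)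
qed

end
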